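(* Let $L$ be the link graph of the random triangular presentation $\Gamma(n,p)$. There exists a constant $C>0$ such that if $p=p(n)\ge C\log n/n^2$, then asymptotically almost surely $\lambda_2[\mathcal L(L)]>1/2$.
   Context: The random triangular group $\Gamma(n,p)$ is given by a presentation $\langle S\mid R\rangle$, where $|S|=n$ and $R$ contains independently, each with probability $p$, every cyclically reduced word $abc$ of length three over $S\cup S^{-1}$ ($a\neq b^{-1}$, $b\neq c^{-1}$, $c\neq a^{-1}$; distinct words are distinct candidates). The link graph $L$ of a triangular presentation $\langle S\mid R\rangle$ is the multigraph with vertex set $S\cup S^{-1}$ (generators and their formal inverses, $2n$ vertices) in which every relation $abc\in R$ contributes the three edges $\{a,b^{-1}\}$, $\{b,c^{-1}\}$, $\{c,a^{-1}\}$ (multiple edges allowed). For a multigraph $G$ with adjacency matrix $A=(a_{vw})$ ($a_{vw}$ = number of edges between $v$ and $w$) and degrees $d_G(v)$, the normalized Laplacian $\mathcal L(G)=(b_{vw})$ has $b_{vv}=1$ if $d_G(v)>0$, $b_{vw}=-a_{vw}/\sqrt{d_G(v)d_G(w)}$ if $v,w$ are adjacent, and $0$ otherwise; its eigenvalues are $0=\lambda_1\le\lambda_2\le\dots$, and $\lambda_2[\mathcal L(G)]$ denotes the second smallest. Asymptotically almost surely means with probability tending to $1$ as $n\to\infty$. *)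

theory Defs
  imports "Jordan_Normal_Form.Char_Poly" "HOL-Probability.Product_PMF"
begin

text \<open>Vertices/letters of S \<union> S^-1 for S = {x_0,...,x_(n-1)}: the natural numbers below 2n;
  v < n stands for the generator x_v, and n + i stands for the formal inverse of x_i.\<close>

definition letter_inv :: "nat \<Rightarrow> nat \<Rightarrow> nat" where
  "letter_inv n v = (if v < n then v + n else v - n)"

definition tri_words :: "nat \<Rightarrow> (nat \<times> nat \<times> nat) set" where
  "tri_words n = {(a, b, c). a < 2 * n \<and> b < 2 * n \<and> c < 2 * n \<and>
      a \<noteq> letter_inv n b \<and> b \<noteq> letter_inv n c \<and> c \<noteq> letter_inv n a}"

definition link_edges :: "nat \<Rightarrow> nat \<times> nat \<times> nat \<Rightarrow> (nat \<times> nat) list" where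
  "link_edges n r = (case r of (a, b, c) \<Rightarrow>
      [(a, letter_inv n b), (b, letter_inv n c), (c, letter_inv n a)])"

definition link_adj :: "nat \<Rightarrow> (nat \<times> nat \<times> nat) set \<Rightarrow> nat \<Rightarrow> nat \<Rightarrow> nat" where
  "link_adj n R v w = (\<Sum>r\<in>R. length (filter (\<lambda>(x, y). (x = v \<and> y = w) \<or> (x = w \<and> y = v))
      (link_edges n r)))"

text \<open>Degree (the link graph has no loops, since relators are cyclically reduced).\<close>
definition link_deg :: "nat \<Rightarrow> (nat \<times> nat \<times> nat) set \<Rightarrow> nat \<Rightarrow> nat" where
  "link_deg n R v = (\<Sum>w<2 * n. link_adj n R v w)"

definition link_laplacian :: "nat \<Rightarrow> (nat \<times> nat \<times> nat) set \<Rightarrow> real Matrix.mat" where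
  "link_laplacian n R = Matrix.mat (2 * n) (2 * n) (\<lambda>(v, w).
      if v = w then (if link_deg n R v > 0 then 1 else 0)
      else - real (link_adj n R v w) / sqrt (real (link_deg n R v) * real (link_deg n R w)))"

text \<open>Second smallest eigenvalue (counted with multiplicity) of a real Matrix.matrix whose
  characteristic polynomial splits over the reals (e.g. a symmetric one).\<close>
definition lambda2 :: "real Matrix.mat \<Rightarrow> real" where
  "lambda2 A = sorted_list_of_multiset (proots (char_poly A)) ! 1"

definition random_tri_pres :: "nat \<Rightarrow> real \<Rightarrow> (nat \<times> nat \<times> nat \<Rightarrow> bool) pmf" where
  "random_tri_pres n p = Pi_pmf (tri_words n) False (\<lambda>_. bernoulli_pmf p)"

definition relators_of :: "nat \<Rightarrow> (nat \<times> nat \<times> nat \<Rightarrow> bool) \<Rightarrow> (nat \<times> nat \<times> nat) set" where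
  "relators_of n f = {w \<in> tri_words n. f w}"

end

theory Submission
  imports Defs "Jordan_Normal_Form.Schur_Decomposition"
begin

text \<open>
  Let \<open>A\<^sub>r\<close> and \<open>D\<^sub>r\<close> be the adjacency and degree matrices of the three edges contributed by a relator
  \<open>r\<close>, let \<open>G\<^sub>r = D\<^sub>r / 2 - A\<^sub>r\<close>, and let \<open>X\<^sub>r\<close> be the indicator of \<open>r\<close> being chosen. The link graph
  satisfies \<open>D / 2 - A = M + p \<Sum>\<^sub>r G\<^sub>r\<close> with \<open>M = \<Sum>\<^sub>r (X\<^sub>r - p) G\<^sub>r\<close>. The deterministic part is
  computed exactly; it exceeds \<open>3 p n\<^sup>2\<close> on vectors orthogonal to the constants, and so do its
  diagonal entries. Hence if \<open>M\<close> has norm at most \<open>3 p n\<^sup>2\<close>, then all degrees are positive and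
  \<open>D / 2 - A\<close> is positive definite on a hyperplane, which forces the second eigenvalue of the
  normalized Laplacian above \<open>1 / 2\<close>.

  The norm of \<open>M\<close> is controlled by the expected trace of \<open>M\<^sup>2\<^sup>k\<close>, where \<open>k\<close> is a power of two between
  \<open>ln n\<close> and \<open>2 ln n\<close>. Expanding the trace into words of relators, only words in which every letter
  occurs at least twice, hence with at most \<open>k\<close> distinct letters, have nonzero expectation. Reading a
  word letter by letter, a new letter can be chosen in about \<open>n\<^sup>2\<close> ways and an old one in at most \<open>2 k\<close>
  ways; since \<open>p n\<^sup>2\<close> is a large multiple of \<open>k\<close>, this crude count suffices.
\<close>

section \<open>Finite real matrices as functions\<close>

text \<open>Matrices are plain functions read only at indices below \<open>N\<close>, so that the
  expansion of traces stays finite-sum algebra.\<close>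

definition fmult :: "nat \<Rightarrow> (nat \<Rightarrow> nat \<Rightarrow> real) \<Rightarrow> (nat \<Rightarrow> nat \<Rightarrow> real) \<Rightarrow> nat \<Rightarrow> nat \<Rightarrow> real" where
  "fmult N A B v w = (\<Sum>u<N. A v u * B u w)"

primrec fpow :: "nat \<Rightarrow> (nat \<Rightarrow> nat \<Rightarrow> real) \<Rightarrow> nat \<Rightarrow> nat \<Rightarrow> nat \<Rightarrow> real" where
  "fpow N A 0 = (\<lambda>v w. of_bool (v = w))"
| "fpow N A (Suc m) = fmult N A (fpow N A m)"

definition ftrace :: "nat \<Rightarrow> (nat \<Rightarrow> nat \<Rightarrow> real) \<Rightarrow> real" where
  "ftrace N A = (\<Sum>v<N. A v v)"

definition quad_form :: "nat \<Rightarrow> (nat \<Rightarrow> nat \<Rightarrow> real) \<Rightarrow> (nat \<Rightarrow> real) \<Rightarrow> real" where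
  "quad_form N A x = (\<Sum>v<N. \<Sum>w<N. A v w * x v * x w)"

definition symmetric_upto :: "nat \<Rightarrow> (nat \<Rightarrow> nat \<Rightarrow> real) \<Rightarrow> bool" where
  "symmetric_upto N A \<longleftrightarrow> (\<forall>v<N. \<forall>w<N. A v w = A w v)"

lemma fpow_add:
  assumes "v < N"
  shows "fpow N A (a + b) v w = fmult N (fpow N A a) (fpow N A b) v w"
  using assms
proof (induction a arbitrary: v)
  case 0
  have "fmult N (fpow N A 0) (fpow N A b) v w = (\<Sum>u<N. if u = v then fpow N A b u w else 0)"
    unfolding fmult_def by (intro sum.cong) auto
  then show ?case using 0 by simp
next
  case (Suc a)
  have "fpow N A (Suc a + b) v w = (\<Sum>u<N. A v u * (\<Sum>t<N. fpow N A a u t * fpow N A b t w))"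
    using Suc.IH by (simp add: fmult_def)
  also have "\<dots> = (\<Sum>t<N. (\<Sum>u<N. A v u * fpow N A a u t) * fpow N A b t w)"
    unfolding sum_distrib_left sum_distrib_right by (subst sum.swap) (simp add: mult.assoc)
  finally show ?case by (simp add: fmult_def)
qed

lemma fpow_1:
  assumes "w < N"
  shows "fpow N A (Suc 0) v w = A v w"
proof -
  have "fpow N A (Suc 0) v w = (\<Sum>t<N. if t = w then A v t else 0)"
    unfolding fpow.simps fmult_def by (intro sum.cong) auto
  then show ?thesis using assms by simp
qed

lemma symmetric_fpow:
  assumes "symmetric_upto N A"
  shows "symmetric_upto N (fpow N A m)"
proof (induction m)
  case 0
  then show ?case by (auto simp: symmetric_upto_def)
next
  case (Suc m)
  have "fpow N A (Suc m) v w = fpow N A (Suc m) w v" if vw: "v < N" "w < N" for v w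
  proof -
    have "fpow N A (Suc m) v w = (\<Sum>u<N. fpow N A m v u * fpow N A (Suc 0) u w)"
      using fpow_add[OF vw(1), of A m "Suc 0" w] by (simp add: fmult_def)
    also have "\<dots> = (\<Sum>u<N. A w u * fpow N A m u v)"
      using Suc assms vw by (intro sum.cong refl) (simp add: fpow_1 symmetric_upto_def mult.commute del: fpow.simps)
    finally show ?thesis by (simp add: fmult_def)
  qed
  then show ?case by (simp add: symmetric_upto_def)
qed

section \<open>Quadratic forms against traces of even powers\<close>

lemma quad_form_scale: "quad_form N A (\<lambda>v. c * x v) = c\<^sup>2 * quad_form N A x"
  by (simp add: quad_form_def sum_distrib_left power2_eq_square algebra_simps)

lemma quad_form_square:
  assumes "symmetric_upto N A"
  shows "quad_form N (fmult N A A) x = (\<Sum>v<N. (\<Sum>w<N. A v w * x w)\<^sup>2)"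
proof -
  have "quad_form N (fmult N A A) x = (\<Sum>v<N. \<Sum>w<N. \<Sum>u<N. (A v u * x v) * (A u w * x w))"
    unfolding quad_form_def fmult_def sum_distrib_right by (simp add: algebra_simps)
  also have "\<dots> = (\<Sum>v<N. \<Sum>u<N. \<Sum>w<N. (A v u * x v) * (A u w * x w))"
    by (intro sum.cong refl sum.swap)
  also have "\<dots> = (\<Sum>u<N. \<Sum>v<N. \<Sum>w<N. (A v u * x v) * (A u w * x w))"
    by (rule sum.swap)
  also have "\<dots> = (\<Sum>u<N. \<Sum>v<N. \<Sum>w<N. (A u v * x v) * (A u w * x w))"
    using assms by (intro sum.cong refl) (simp add: symmetric_upto_def)
  finally show ?thesis by (simp add: power2_eq_square sum_product)
qed

text \<open>Cauchy-Schwarz for \<open>x\<close> and \<open>A x\<close>; by symmetry the squared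
  length of \<open>A x\<close> is the quadratic form of the square of \<open>A\<close>.\<close>

lemma quad_form_squared_le:
  assumes "symmetric_upto N A" and unit: "(\<Sum>v<N. (x v)\<^sup>2) = 1"
  shows "(quad_form N A x)\<^sup>2 \<le> quad_form N (fmult N A A) x"
proof -
  have "quad_form N A x = (\<Sum>v<N. x v * (\<Sum>w<N. A v w * x w))"
    by (simp add: quad_form_def sum_distrib_left algebra_simps)
  then have "(quad_form N A x)\<^sup>2 \<le> (\<Sum>v<N. (x v)\<^sup>2) * (\<Sum>v<N. (\<Sum>w<N. A v w * x w)\<^sup>2)"
    using Cauchy_Schwarz_ineq_sum[of x "\<lambda>v. \<Sum>w<N. A v w * x w" "{..<N}"] by simp
  then show ?thesis using quad_form_square[OF assms(1)] unit by simp
qed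

lemma quad_form_fpow_double:
  "quad_form N (fpow N A (m + m)) x = quad_form N (fmult N (fpow N A m) (fpow N A m)) x"
  unfolding quad_form_def by (intro sum.cong refl) (simp add: fpow_add)

text \<open>Repeated squaring with \<open>quad_form_squared_le\<close>. It reaches only exponents
  that are powers of two, which is why \<open>k\<close> is later taken of this form.\<close>

lemma quad_form_power_le:
  assumes "symmetric_upto N A" and unit: "(\<Sum>v<N. (x v)\<^sup>2) = 1"
  shows "\<bar>quad_form N A x\<bar> ^ (2 ^ j) \<le> \<bar>quad_form N (fpow N A (2 ^ j)) x\<bar>"
proof (induction j)
  case 0
  show ?case by (simp add: quad_form_def fpow_1 del: fpow.simps)
next
  case (Suc j)
  have "\<bar>quad_form N A x\<bar> ^ (2 ^ Suc j) = (\<bar>quad_form N A x\<bar> ^ (2 ^ j))\<^sup>2"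
    by (simp add: power_mult[symmetric] mult.commute)
  also have "\<dots> \<le> (quad_form N (fpow N A (2 ^ j)) x)\<^sup>2"
    using power_mono[OF Suc, of 2] by simp
  also have "\<dots> \<le> quad_form N (fmult N (fpow N A (2 ^ j)) (fpow N A (2 ^ j))) x"
    by (intro quad_form_squared_le symmetric_fpow assms)
  also have "\<dots> = quad_form N (fpow N A (2 ^ Suc j)) x"
    by (simp add: quad_form_fpow_double mult_2)
  finally show ?case by linarith
qed

lemma ftrace_fpow_double:
  assumes "symmetric_upto N A"
  shows "ftrace N (fpow N A (m + m)) = (\<Sum>v<N. \<Sum>w<N. (fpow N A m v w)\<^sup>2)"
proof -
  have "ftrace N (fpow N A (m + m)) = (\<Sum>v<N. \<Sum>w<N. fpow N A m v w * fpow N A m w v)"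
    unfolding ftrace_def by (intro sum.cong refl) (simp add: fpow_add fmult_def)
  also have "\<dots> = (\<Sum>v<N. \<Sum>w<N. (fpow N A m v w)\<^sup>2)"
    using symmetric_fpow[OF assms, of m]
    by (intro sum.cong refl) (simp add: symmetric_upto_def power2_eq_square)
  finally show ?thesis .
qed

text \<open>With \<open>B = A^m\<close>, the form of \<open>B^2\<close> at \<open>x\<close> is the
  squared length of \<open>B x\<close>. For a unit vector this is at most the squared Frobenius norm
  of \<open>B\<close>, which is the trace of \<open>B^2\<close>.\<close>

lemma quad_form_fpow_le_ftrace:
  assumes "symmetric_upto N A" and unit: "(\<Sum>v<N. (x v)\<^sup>2) = 1"
  shows "0 \<le> quad_form N (fpow N A (m + m)) x"
    and "quad_form N (fpow N A (m + m)) x \<le> ftrace N (fpow N A (m + m))"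
proof -
  let ?B = "fpow N A m"
  have sym: "symmetric_upto N ?B" by (rule symmetric_fpow[OF assms(1)])
  have eq: "quad_form N (fpow N A (m + m)) x = (\<Sum>v<N. (\<Sum>w<N. ?B v w * x w)\<^sup>2)"
    by (simp add: quad_form_fpow_double quad_form_square[OF sym])
  show "0 \<le> quad_form N (fpow N A (m + m)) x"
    unfolding eq by (intro sum_nonneg) simp
  have "(\<Sum>w<N. ?B v w * x w)\<^sup>2 \<le> (\<Sum>w<N. (?B v w)\<^sup>2)" for v
    using Cauchy_Schwarz_ineq_sum[of "?B v" x "{..<N}"] unit by simp
  then have "quad_form N (fpow N A (m + m)) x \<le> (\<Sum>v<N. \<Sum>w<N. (?B v w)\<^sup>2)"
    unfolding eq by (intro sum_mono)
  then show "quad_form N (fpow N A (m + m)) x \<le> ftrace N (fpow N A (m + m))"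
    by (simp only: ftrace_fpow_double[OF assms(1)])
qed

text \<open>Bounds the norm by a trace without diagonalizing \<open>A\<close>: the two preceding
  bounds are chained at the normalized vector and a root is taken. The exponent \<open>Suc j\<close>
  makes \<open>m\<close> even, so that the trace is a sum of squares.\<close>

lemma abs_quad_form_le:
  assumes sym: "symmetric_upto N A" and "0 \<le> t" and m: "m = 2 ^ Suc j"
    and tr: "ftrace N (fpow N A m) \<le> t ^ m"
  shows "\<bar>quad_form N A x\<bar> \<le> t * (\<Sum>v<N. (x v)\<^sup>2)"
proof (cases "(\<Sum>v<N. (x v)\<^sup>2) = 0")
  case True
  then have "\<forall>v\<in>{..<N}. (x v)\<^sup>2 = 0" by (subst (asm) sum_nonneg_eq_0_iff) auto
  then show ?thesis by (simp add: quad_form_def True)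
next
  case False
  define S where "S = (\<Sum>v<N. (x v)\<^sup>2)"
  have S: "S > 0" using False sum_nonneg[of "{..<N}" "\<lambda>v. (x v)\<^sup>2"] unfolding S_def by auto
  define y where "y v = (1 / sqrt S) * x v" for v
  have "(\<Sum>v<N. (y v)\<^sup>2) = S / S"
    unfolding y_def S_def[symmetric] power_mult_distrib sum_distrib_left[symmetric]
    using S by (simp add: power_divide S_def[symmetric])
  then have unit: "(\<Sum>v<N. (y v)\<^sup>2) = 1" using S by simp
  have mm: "m = 2 ^ j + 2 ^ j" using m by simp
  have "\<bar>quad_form N A y\<bar> ^ m \<le> \<bar>quad_form N (fpow N A m) y\<bar>"
    unfolding m by (rule quad_form_power_le[OF sym unit])
  also have "\<dots> \<le> t ^ m"
    using quad_form_fpow_le_ftrace[OF sym unit, of "2 ^ j"] tr unfolding mm by linarith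
  finally have "\<bar>quad_form N A y\<bar> \<le> t"
    using \<open>0 \<le> t\<close> m by (subst (asm) power_mono_iff) auto
  moreover have "quad_form N A y = quad_form N A x / S"
    unfolding y_def quad_form_scale using S by (simp add: power_divide)
  ultimately show ?thesis using S unfolding S_def[symmetric] by (simp add: field_simps)
qed

section \<open>Moments of random matrix series\<close>

primrec word_mat :: "nat \<Rightarrow> ('r \<Rightarrow> nat \<Rightarrow> nat \<Rightarrow> real) \<Rightarrow> 'r list \<Rightarrow> nat \<Rightarrow> nat \<Rightarrow> real" where
  "word_mat N G [] = (\<lambda>v w. of_bool (v = w))"
| "word_mat N G (r # rs) = fmult N (G r) (word_mat N G rs)"

definition words_of :: "'r set \<Rightarrow> nat \<Rightarrow> 'r list set" where
  "words_of T m = {rs. set rs \<subseteq> T \<and> length rs = m}"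

lemma words_of_0: "words_of T 0 = {[]}"
  by (auto simp: words_of_def)

lemma sum_words_of_Suc:
  fixes f :: "'r list \<Rightarrow> real"
  shows "(\<Sum>rs\<in>words_of T (Suc m). f rs) = (\<Sum>r\<in>T. \<Sum>rs\<in>words_of T m. f (r # rs))"
proof -
  have eq: "words_of T (Suc m) = (\<lambda>(r, rs). r # rs) ` (T \<times> words_of T m)"
    by (auto simp: words_of_def length_Suc_conv)
  have "(\<Sum>rs\<in>words_of T (Suc m). f rs) = (\<Sum>(r, rs)\<in>T \<times> words_of T m. f (r # rs))"
    unfolding eq by (subst sum.reindex) (auto simp: inj_on_def intro!: sum.cong)
  then show ?thesis by (simp add: sum.cartesian_product)
qed

text \<open>The noncommutative multinomial expansion: scalars are pulled out of the product, and the
  word records the order of the matrices.\<close>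

lemma fpow_sum_eq_sum_words:
  "fpow N (\<lambda>v w. \<Sum>r\<in>T. Y r * G r v w) m v w =
     (\<Sum>rs\<in>words_of T m. (\<Prod>r\<leftarrow>rs. Y r) * word_mat N G rs v w)"
proof (induction m arbitrary: v)
  case 0
  then show ?case by (simp add: words_of_0)
next
  case (Suc m)
  have "fpow N (\<lambda>v w. \<Sum>r\<in>T. Y r * G r v w) (Suc m) v w =
     (\<Sum>u<N. (\<Sum>r\<in>T. Y r * G r v u) * (\<Sum>rs\<in>words_of T m. (\<Prod>r\<leftarrow>rs. Y r) * word_mat N G rs u w))"
    by (simp add: fmult_def Suc)
  also have "\<dots> = (\<Sum>u<N. \<Sum>r\<in>T. \<Sum>rs\<in>words_of T m.
      (Y r * (\<Prod>r\<leftarrow>rs. Y r)) * (G r v u * word_mat N G rs u w))"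
    by (simp add: sum_product algebra_simps)
  also have "\<dots> = (\<Sum>r\<in>T. \<Sum>u<N. \<Sum>rs\<in>words_of T m.
      (Y r * (\<Prod>r\<leftarrow>rs. Y r)) * (G r v u * word_mat N G rs u w))"
    by (rule sum.swap)
  also have "\<dots> = (\<Sum>r\<in>T. \<Sum>rs\<in>words_of T m. \<Sum>u<N.
      (Y r * (\<Prod>r\<leftarrow>rs. Y r)) * (G r v u * word_mat N G rs u w))"
    by (intro sum.cong refl sum.swap)
  also have "\<dots> = (\<Sum>rs\<in>words_of T (Suc m). (\<Prod>r\<leftarrow>rs. Y r) * word_mat N G rs v w)"
    by (simp add: sum_words_of_Suc fmult_def sum_distrib_left)
  finally show ?case .
qed

text \<open>The entrywise l1 norm. It dominates the trace and, unlike the trace, obeys a recursion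
  when a letter is prepended to the word.\<close>

definition word_mass :: "nat \<Rightarrow> ('r \<Rightarrow> nat \<Rightarrow> nat \<Rightarrow> real) \<Rightarrow> 'r list \<Rightarrow> real" where
  "word_mass N G rs = (\<Sum>v<N. \<Sum>w<N. \<bar>word_mat N G rs v w\<bar>)"

lemma word_mass_nonneg: "0 \<le> word_mass N G rs"
  unfolding word_mass_def by (intro sum_nonneg) simp

lemma abs_ftrace_word_mat_le: "\<bar>ftrace N (word_mat N G rs)\<bar> \<le> word_mass N G rs"
proof -
  have "\<bar>ftrace N (word_mat N G rs)\<bar> \<le> (\<Sum>v<N. \<bar>word_mat N G rs v v\<bar>)"
    unfolding ftrace_def by (rule sum_abs)
  also have "\<dots> \<le> word_mass N G rs"
    unfolding word_mass_def by (intro sum_mono member_le_sum[of _ _ "\<lambda>w. \<bar>word_mat N G rs _ w\<bar>"]) auto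
  finally show ?thesis .
qed

lemma word_mass_Cons_le:
  "word_mass N G (r # rs) \<le> (\<Sum>u<N. (\<Sum>v<N. \<bar>G r v u\<bar>) * (\<Sum>w<N. \<bar>word_mat N G rs u w\<bar>))"
proof -
  have "word_mass N G (r # rs) \<le> (\<Sum>v<N. \<Sum>w<N. \<Sum>u<N. \<bar>G r v u\<bar> * \<bar>word_mat N G rs u w\<bar>)"
    unfolding word_mass_def word_mat.simps fmult_def
    by (intro sum_mono order.trans[OF sum_abs]) (simp add: abs_mult)
  also have "\<dots> = (\<Sum>v<N. \<Sum>u<N. \<Sum>w<N. \<bar>G r v u\<bar> * \<bar>word_mat N G rs u w\<bar>)"
    by (intro sum.cong refl sum.swap)
  also have "\<dots> = (\<Sum>u<N. \<Sum>v<N. \<Sum>w<N. \<bar>G r v u\<bar> * \<bar>word_mat N G rs u w\<bar>)"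
    by (rule sum.swap)
  finally show ?thesis by (simp add: sum_product)
qed

text \<open>A new letter costs the total column sum \<open>B\<close> and a factor \<open>z\<close>, whereas a repeated letter
  can be chosen in at most \<open>m\<close> ways and costs only its own column sum \<open>c\<close>.\<close>

lemma weighted_word_mass_Suc_le:
  assumes "finite T" "0 \<le> z" "0 \<le> c"
    and c: "\<And>r u. r \<in> T \<Longrightarrow> u < N \<Longrightarrow> (\<Sum>v<N. \<bar>G r v u\<bar>) \<le> c"
    and B: "\<And>u. u < N \<Longrightarrow> (\<Sum>r\<in>T. \<Sum>v<N. \<bar>G r v u\<bar>) \<le> B"
  shows "(\<Sum>rs\<in>words_of T (Suc m). z ^ card (set rs) * word_mass N G rs)
    \<le> (z * B + c * real m) * (\<Sum>rs\<in>words_of T m. z ^ card (set rs) * word_mass N G rs)"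
proof -
  have step: "(\<Sum>r\<in>T. z ^ card (set (r # rs)) * word_mass N G (r # rs))
      \<le> (z * B + c * real m) * (z ^ card (set rs) * word_mass N G rs)"
    if rs: "rs \<in> words_of T m" for rs
  proof -
    let ?W = "\<lambda>u. \<Sum>w<N. \<bar>word_mat N G rs u w\<bar>"
    let ?k = "card (set rs)"
    have W: "0 \<le> ?W u" for u by (intro sum_nonneg) simp
    have mass: "word_mass N G rs = (\<Sum>u<N. ?W u)" by (simp add: word_mass_def)
    have sub: "set rs \<subseteq> T" and len: "length rs = m" using rs by (auto simp: words_of_def)
    have old: "(\<Sum>r\<in>set rs. z ^ card (set (r # rs)) * word_mass N G (r # rs))
        \<le> c * real m * (z ^ ?k * word_mass N G rs)"
    proof -
      have "(\<Sum>r\<in>set rs. z ^ card (set (r # rs)) * word_mass N G (r # rs))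
          \<le> (\<Sum>r\<in>set rs. z ^ ?k * (c * word_mass N G rs))"
      proof (intro sum_mono)
        fix r assume r: "r \<in> set rs"
        have "word_mass N G (r # rs) \<le> (\<Sum>u<N. c * ?W u)"
          using c r sub W by (intro order.trans[OF word_mass_Cons_le] sum_mono mult_right_mono) auto
        then have "word_mass N G (r # rs) \<le> c * word_mass N G rs"
          by (simp add: mass sum_distrib_left)
        then show "z ^ card (set (r # rs)) * word_mass N G (r # rs) \<le> z ^ ?k * (c * word_mass N G rs)"
          using r \<open>0 \<le> z\<close> by (simp add: insert_absorb mult_left_mono)
      qed
      also have "\<dots> = real ?k * (z ^ ?k * (c * word_mass N G rs))" by simp
      also have "\<dots> \<le> real m * (z ^ ?k * (c * word_mass N G rs))"
        using card_length[of rs] len assms(2,3) word_mass_nonneg[of N G rs]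
        by (intro mult_right_mono) auto
      finally show ?thesis by (simp add: algebra_simps)
    qed
    have new: "(\<Sum>r\<in>T - set rs. z ^ card (set (r # rs)) * word_mass N G (r # rs))
        \<le> z * B * (z ^ ?k * word_mass N G rs)"
    proof -
      have "(\<Sum>r\<in>T - set rs. z ^ card (set (r # rs)) * word_mass N G (r # rs))
          \<le> (\<Sum>r\<in>T - set rs. z ^ Suc ?k * (\<Sum>u<N. (\<Sum>v<N. \<bar>G r v u\<bar>) * ?W u))"
        using \<open>0 \<le> z\<close> by (intro sum_mono) (auto intro!: mult_left_mono word_mass_Cons_le)
      also have "\<dots> \<le> (\<Sum>r\<in>T. z ^ Suc ?k * (\<Sum>u<N. (\<Sum>v<N. \<bar>G r v u\<bar>) * ?W u))"
        using assms(1,2) W by (intro sum_mono2) (auto intro!: mult_nonneg_nonneg sum_nonneg)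
      also have "\<dots> = z ^ Suc ?k * (\<Sum>u<N. (\<Sum>r\<in>T. \<Sum>v<N. \<bar>G r v u\<bar>) * ?W u)"
        unfolding sum_distrib_left[symmetric] by (subst sum.swap) (simp add: sum_distrib_right)
      also have "\<dots> \<le> z ^ Suc ?k * (\<Sum>u<N. B * ?W u)"
        using \<open>0 \<le> z\<close> B W by (intro mult_left_mono sum_mono mult_right_mono) auto
      also have "\<dots> = z * B * (z ^ ?k * word_mass N G rs)"
        by (simp add: mass sum_distrib_left algebra_simps)
      finally show ?thesis .
    qed
    have "(\<Sum>r\<in>T. z ^ card (set (r # rs)) * word_mass N G (r # rs)) =
        (\<Sum>r\<in>T - set rs. z ^ card (set (r # rs)) * word_mass N G (r # rs)) +
        (\<Sum>r\<in>set rs. z ^ card (set (r # rs)) * word_mass N G (r # rs))"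
      using sub \<open>finite T\<close> by (rule sum.subset_diff)
    then show ?thesis using old new by (simp add: algebra_simps)
  qed
  have "(\<Sum>rs\<in>words_of T (Suc m). z ^ card (set rs) * word_mass N G rs)
      = (\<Sum>rs\<in>words_of T m. \<Sum>r\<in>T. z ^ card (set (r # rs)) * word_mass N G (r # rs))"
    unfolding sum_words_of_Suc by (rule sum.swap)
  also have "\<dots> \<le> (\<Sum>rs\<in>words_of T m. (z * B + c * real m) * (z ^ card (set rs) * word_mass N G rs))"
    by (intro sum_mono step)
  finally show ?thesis by (simp add: sum_distrib_left)
qed

text \<open>Iterates the preceding step from the empty word, whose mass is \<open>N\<close>;
  bounding the word length by the fixed \<open>l\<close> makes the factor the same at every
  step.\<close>

lemma weighted_word_mass_le:
  assumes "finite T" "0 \<le> z" "0 \<le> c" "0 \<le> B"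
    and c: "\<And>r u. r \<in> T \<Longrightarrow> u < N \<Longrightarrow> (\<Sum>v<N. \<bar>G r v u\<bar>) \<le> c"
    and B: "\<And>u. u < N \<Longrightarrow> (\<Sum>r\<in>T. \<Sum>v<N. \<bar>G r v u\<bar>) \<le> B"
    and "m \<le> l"
  shows "(\<Sum>rs\<in>words_of T m. z ^ card (set rs) * word_mass N G rs) \<le> real N * (z * B + c * real l) ^ m"
  using \<open>m \<le> l\<close>
proof (induction m)
  case 0
  have "(\<Sum>v<N. \<Sum>w<N. \<bar>of_bool (v = w)\<bar>) = (\<Sum>v<N. 1 :: real)"
  proof (intro sum.cong refl)
    fix v assume "v \<in> {..<N}"
    moreover have "(\<Sum>w<N. \<bar>of_bool (v = w)\<bar>) = (\<Sum>w<N. if w = v then 1 else 0 :: real)"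
      by (intro sum.cong) auto
    ultimately show "(\<Sum>w<N. \<bar>of_bool (v = w)\<bar>) = (1 :: real)" by simp
  qed
  then show ?case by (simp add: words_of_0 word_mass_def)
next
  case (Suc m)
  have "(\<Sum>rs\<in>words_of T (Suc m). z ^ card (set rs) * word_mass N G rs)
    \<le> (z * B + c * real m) * (\<Sum>rs\<in>words_of T m. z ^ card (set rs) * word_mass N G rs)"
    by (rule weighted_word_mass_Suc_le[OF assms(1-3) c B])
  also have "\<dots> \<le> (z * B + c * real l) * (real N * (z * B + c * real l) ^ m)"
    using Suc assms(2-4) by (intro mult_mono add_mono mult_left_mono sum_nonneg)
      (auto intro!: mult_nonneg_nonneg word_mass_nonneg)
  finally show ?case by (simp add: algebra_simps)
qed

section \<open>Moments of centered Bernoulli variables along a word\<close>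

lemma finite_set_Pi_pmf_bernoulli:
  "finite T \<Longrightarrow> finite (set_pmf (Pi_pmf T False (\<lambda>_. bernoulli_pmf p)))"
  by (rule finite_subset[OF set_Pi_pmf_subset']) auto

lemma expectation_prod_centered_bernoulli:
  fixes p :: real
  assumes "finite T"
  shows "measure_pmf.expectation (Pi_pmf T False (\<lambda>_. bernoulli_pmf p))
      (\<lambda>f. \<Prod>r\<in>T. (of_bool (f r) - p) ^ e r) =
    (\<Prod>r\<in>T. measure_pmf.expectation (bernoulli_pmf p) (\<lambda>b. (of_bool b - p) ^ e r))"
proof -
  let ?P = "Pi_pmf T False (\<lambda>_. bernoulli_pmf p)"
  have "prob_space.indep_vars (measure_pmf ?P) (\<lambda>_. borel)
      (\<lambda>r f. (\<lambda>b. (of_bool b - p) ^ e r) (f r)) T"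
    by (rule prob_space.indep_vars_compose2[OF measure_pmf.prob_space_axioms indep_vars_Pi_pmf[OF assms]]) simp
  then have "measure_pmf.expectation ?P (\<lambda>f. \<Prod>r\<in>T. (of_bool (f r) - p) ^ e r) =
      (\<Prod>r\<in>T. measure_pmf.expectation ?P (\<lambda>f. (of_bool (f r) - p) ^ e r))"
    using assms by (intro prob_space.indep_vars_lebesgue_integral measure_pmf.prob_space_axioms
      integrable_measure_pmf_finite finite_set_Pi_pmf_bernoulli) auto
  also have "\<dots> = (\<Prod>r\<in>T. measure_pmf.expectation (map_pmf (\<lambda>f. f r) ?P) (\<lambda>b. (of_bool b - p) ^ e r))"
    by simp
  also have "\<dots> = (\<Prod>r\<in>T. measure_pmf.expectation (bernoulli_pmf p) (\<lambda>b. (of_bool b - p) ^ e r))"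
    using assms by (intro prod.cong refl) (simp add: Pi_pmf_component del: integral_map_pmf)
  finally show ?thesis .
qed

text \<open>The moment is \<open>(1 - p)^a p + (-p)^a (1 - p)\<close>; for \<open>a \<ge> 2\<close>
  its absolute value is at most \<open>p (1 - p) + p^2 (1 - p) = p - p^3\<close>.\<close>

lemma abs_centered_bernoulli_moment_le:
  fixes p :: real
  assumes p: "0 \<le> p" "p \<le> 1" and "2 \<le> a"
  shows "\<bar>measure_pmf.expectation (bernoulli_pmf p) (\<lambda>b. (of_bool b - p) ^ a)\<bar> \<le> p"
proof -
  have 1: "(1 - p) ^ a \<le> 1 - p"
    using power_decreasing[of 1 a "1 - p"] assms by simp
  have 2: "p ^ a \<le> p\<^sup>2"
    using power_decreasing[of 2 a p] assms by simp
  have "\<bar>measure_pmf.expectation (bernoulli_pmf p) (\<lambda>b. (of_bool b - p) ^ a)\<bar>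
      \<le> (1 - p) ^ a * p + p ^ a * (1 - p)"
    using p by (simp, intro order.trans[OF abs_triangle_ineq]) (simp add: abs_mult power_abs)
  also have "\<dots> \<le> (1 - p) * p + p\<^sup>2 * (1 - p)"
    using 1 2 p by (intro add_mono mult_right_mono) auto
  also have "\<dots> = p - p ^ 3" by (simp add: algebra_simps power2_eq_square power3_eq_cube)
  also have "\<dots> \<le> p" using p by simp
  finally show ?thesis .
qed

lemma prod_list_eq_prod_count:
  fixes Y :: "'r \<Rightarrow> real"
  assumes "finite T" "set rs \<subseteq> T"
  shows "(\<Prod>r\<leftarrow>rs. Y r) = (\<Prod>r\<in>T. Y r ^ count_list rs r)"
  using assms(2)
proof (induction rs)
  case (Cons a rs)
  have "(\<Prod>r\<in>T. Y r ^ count_list (a # rs) r) = (\<Prod>r\<in>T. (if r = a then Y r else 1) * Y r ^ count_list rs r)"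
    by (intro prod.cong) auto
  also have "\<dots> = Y a * (\<Prod>r\<in>T. Y r ^ count_list rs r)"
    using Cons.prems \<open>finite T\<close> by (simp add: prod.distrib)
  finally show ?case using Cons by simp
qed simp

text \<open>Independence splits the expectation over the letters of the word. A letter occurring
  once contributes a vanishing first moment. Otherwise every letter occurs at least twice, so at
  most \<open>k\<close> are distinct, and each contributes at most \<open>p\<close>.\<close>

lemma abs_expectation_word_le:
  fixes p :: real
  assumes "finite T" and p: "0 \<le> p" "p \<le> 1" and rs: "rs \<in> words_of T (2 * k)"
  shows "\<bar>measure_pmf.expectation (Pi_pmf T False (\<lambda>_. bernoulli_pmf p)) (\<lambda>f. \<Prod>r\<leftarrow>rs. of_bool (f r) - p)\<bar>
    \<le> (if card (set rs) \<le> k then p ^ card (set rs) else 0)"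
proof -
  let ?E = "\<lambda>a. measure_pmf.expectation (bernoulli_pmf p) (\<lambda>b. (of_bool b - p) ^ a)"
  have sub: "set rs \<subseteq> T" and len: "length rs = 2 * k" using rs by (auto simp: words_of_def)
  have eq: "measure_pmf.expectation (Pi_pmf T False (\<lambda>_. bernoulli_pmf p)) (\<lambda>f. \<Prod>r\<leftarrow>rs. of_bool (f r) - p)
      = (\<Prod>r\<in>T. ?E (count_list rs r))"
    unfolding prod_list_eq_prod_count[OF \<open>finite T\<close> sub]
    by (rule expectation_prod_centered_bernoulli[OF \<open>finite T\<close>])
  \<comment> \<open>Letters outside the word have exponent 0 and contribute the factor 1.\<close>
  also have "\<dots> = (\<Prod>r\<in>set rs. ?E (count_list rs r))"
    using sub \<open>finite T\<close> by (intro prod.mono_neutral_right) (auto simp: count_notin)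
  finally have eq: "measure_pmf.expectation (Pi_pmf T False (\<lambda>_. bernoulli_pmf p)) (\<lambda>f. \<Prod>r\<leftarrow>rs. of_bool (f r) - p)
      = (\<Prod>r\<in>set rs. ?E (count_list rs r))" .
  show ?thesis
  proof (cases "\<exists>r\<in>set rs. count_list rs r = 1")
    case True
    then obtain r where r: "r \<in> set rs" "count_list rs r = 1" by blast
    have "?E 1 = 0" using p by (simp add: algebra_simps)
    then have zero: "(\<Prod>r\<in>set rs. ?E (count_list rs r)) = 0"
      using r by (intro prod_zero bexI[of _ r]) (simp_all only: finite_set)
    show ?thesis unfolding eq zero using p by simp
  next
    case False
    have two: "2 \<le> count_list rs r" if "r \<in> set rs" for r
    proof -
      have "count_list rs r \<noteq> 0" "count_list rs r \<noteq> 1"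
        using that False by (auto simp: count_list_0_iff)
      then show ?thesis by linarith
    qed
    have "card (set rs) * 2 \<le> (\<Sum>r\<in>set rs. count_list rs r)"
      using sum_mono[of "set rs" "\<lambda>_. 2" "count_list rs"] two by simp
    also have "\<dots> = 2 * k" using len sum_count_set[of rs "set rs"] by simp
    finally have "card (set rs) \<le> k" by simp
    moreover have "\<bar>\<Prod>r\<in>set rs. ?E (count_list rs r)\<bar> \<le> (\<Prod>r\<in>set rs. p)"
      unfolding abs_prod using two abs_centered_bernoulli_moment_le[OF p] by (intro prod_mono) auto
    ultimately show ?thesis unfolding eq prod_constant by (simp del: integral_bernoulli_pmf)
  qed
qed

text \<open>The weight \<open>z\<close> is a free parameter: for \<open>d \<le> k\<close> distinct
  letters, \<open>p^d = (p/z)^d z^d \<le> (p/z)^k z^d\<close> because \<open>p/z \<ge> 1\<close>. A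
  suitable \<open>z\<close> balances the cost \<open>z * B\<close> of new letters against the cost
  \<open>c * 2k\<close> of repeated ones.\<close>

lemma expectation_ftrace_fpow_le:
  fixes p z :: real and G :: "'r \<Rightarrow> nat \<Rightarrow> nat \<Rightarrow> real"
  assumes "finite T" "0 < z" "z \<le> p" "p \<le> 1" "0 \<le> c" "0 \<le> B"
    and c: "\<And>r u. r \<in> T \<Longrightarrow> u < N \<Longrightarrow> (\<Sum>v<N. \<bar>G r v u\<bar>) \<le> c"
    and B: "\<And>u. u < N \<Longrightarrow> (\<Sum>r\<in>T. \<Sum>v<N. \<bar>G r v u\<bar>) \<le> B"
  shows "measure_pmf.expectation (Pi_pmf T False (\<lambda>_. bernoulli_pmf p))
      (\<lambda>f. ftrace N (fpow N (\<lambda>v w. \<Sum>r\<in>T. (of_bool (f r) - p) * G r v w) (2 * k)))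
    \<le> (p / z) ^ k * (real N * (z * B + c * real (2 * k)) ^ (2 * k))"
proof -
  let ?P = "Pi_pmf T False (\<lambda>_. bernoulli_pmf p)"
  let ?L = "words_of T (2 * k)"
  let ?W = "\<lambda>f rs. (\<Prod>r\<leftarrow>rs. of_bool (f r) - p) :: real"
  have p: "0 \<le> p" using assms by simp
  have int: "integrable (measure_pmf ?P) h" for h :: "_ \<Rightarrow> real"
    by (intro integrable_measure_pmf_finite finite_set_Pi_pmf_bernoulli assms)
  have "ftrace N (fpow N (\<lambda>v w. \<Sum>r\<in>T. (of_bool (f r) - p) * G r v w) (2 * k))
      = (\<Sum>rs\<in>?L. ?W f rs * ftrace N (word_mat N G rs))" for f
    unfolding ftrace_def fpow_sum_eq_sum_words sum_distrib_left by (rule sum.swap)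
  then have "measure_pmf.expectation ?P
      (\<lambda>f. ftrace N (fpow N (\<lambda>v w. \<Sum>r\<in>T. (of_bool (f r) - p) * G r v w) (2 * k)))
    = (\<Sum>rs\<in>?L. measure_pmf.expectation ?P (\<lambda>f. ?W f rs) * ftrace N (word_mat N G rs))"
    by (simp only: Bochner_Integration.integral_sum[OF int] integral_mult_left_zero)
  also have "\<dots> \<le> (\<Sum>rs\<in>?L. (p / z) ^ k * (z ^ card (set rs) * word_mass N G rs))"
  proof (intro sum_mono)
    fix rs assume rs: "rs \<in> ?L"
    have le: "(if card (set rs) \<le> k then p ^ card (set rs) else 0) \<le> (p / z) ^ k * z ^ card (set rs)"
    proof (cases "card (set rs) \<le> k")
      case True
      have "p ^ card (set rs) = (p / z) ^ card (set rs) * z ^ card (set rs)"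
        using assms(2) by (simp add: power_divide)
      also have "\<dots> \<le> (p / z) ^ k * z ^ card (set rs)"
        using assms(2,3) True by (intro mult_right_mono power_increasing) auto
      finally show ?thesis using True by simp
    qed (use assms(2) p in auto)
    have "measure_pmf.expectation ?P (\<lambda>f. ?W f rs) * ftrace N (word_mat N G rs)
        \<le> \<bar>measure_pmf.expectation ?P (\<lambda>f. ?W f rs)\<bar> * \<bar>ftrace N (word_mat N G rs)\<bar>"
      by (rule order.trans[OF abs_ge_self]) (simp only: abs_mult order.refl)
    also have "\<dots> \<le> ((p / z) ^ k * z ^ card (set rs)) * word_mass N G rs"
      using p assms(2)
      by (intro mult_mono abs_ftrace_word_mat_le order.trans[OF abs_expectation_word_le[OF assms(1) p assms(4) rs] le]
          mult_nonneg_nonneg zero_le_power divide_nonneg_pos) simp_all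
    finally show "measure_pmf.expectation ?P (\<lambda>f. ?W f rs) * ftrace N (word_mat N G rs)
        \<le> (p / z) ^ k * (z ^ card (set rs) * word_mass N G rs)" by (simp add: mult.assoc)
  qed
  also have "\<dots> = (p / z) ^ k * (\<Sum>rs\<in>?L. z ^ card (set rs) * word_mass N G rs)"
    by (simp add: sum_distrib_left)
  also have "\<dots> \<le> (p / z) ^ k * (real N * (z * B + c * real (2 * k)) ^ (2 * k))"
    using assms(2,3) by (intro mult_left_mono weighted_word_mass_le[OF assms(1) _ assms(5,6) c B]) auto
  finally show ?thesis .
qed

section \<open>Second smallest eigenvalue of a symmetric matrix\<close>

unbundle no inner_syntax

text \<open>For a complex eigenvector \<open>v\<close>, the Hermitian form \<open>q\<close> of
  \<open>A\<close> at \<open>v\<close> is real by symmetry, and it equals \<open>a\<close> times the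
  nonzero squared length \<open>s\<close> of \<open>v\<close>.\<close>

lemma real_symmetric_root_real:
  fixes A :: "real Matrix.mat"
  assumes A: "A \<in> carrier_mat N N" and sym: "A\<^sup>T = A"
    and root: "poly (char_poly (map_mat complex_of_real A)) a = 0"
  shows "a \<in> \<real>"
proof -
  let ?C = "map_mat complex_of_real A"
  have C: "?C \<in> carrier_mat N N" using A by simp
  have Aij: "A $$ (i, j) = A $$ (j, i)" if "i < N" "j < N" for i j
    using that A sym by (metis carrier_matD index_transpose_mat(1))
  obtain v where "eigenvector ?C v a"
    using root eigenvalue_root_char_poly[OF C] unfolding eigenvalue_def by blast
  then have v: "v \<in> carrier_vec N" "v \<noteq> 0\<^sub>v N" and ev: "?C *\<^sub>v v = a \<cdot>\<^sub>v v"
    using C A unfolding eigenvector_def by auto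
  have row: "(\<Sum>j<N. of_real (A $$ (i, j)) * v $ j) = a * v $ i" if "i < N" for i
  proof -
    have "(?C *\<^sub>v v) $ i = (\<Sum>j<N. of_real (A $$ (i, j)) * v $ j)"
      using that A v by (simp add: scalar_prod_def atLeast0LessThan)
    then show ?thesis using that v by (simp add: ev)
  qed
  define q where "q = (\<Sum>i<N. \<Sum>j<N. of_real (A $$ (i, j)) * v $ j * cnj (v $ i))"
  define s where "s = (\<Sum>i<N. (cmod (v $ i))\<^sup>2)"
  have "q = (\<Sum>i<N. a * v $ i * cnj (v $ i))"
    unfolding q_def sum_distrib_right[symmetric] using row by simp
  then have q: "q = a * of_real s"
    unfolding s_def of_real_sum complex_norm_square sum_distrib_left by (simp only: mult.assoc)
  have "cnj q = (\<Sum>i<N. \<Sum>j<N. of_real (A $$ (i, j)) * cnj (v $ j) * v $ i)"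
    by (simp add: q_def)
  also have "\<dots> = (\<Sum>j<N. \<Sum>i<N. of_real (A $$ (i, j)) * cnj (v $ j) * v $ i)"
    by (rule sum.swap)
  also have "\<dots> = q"
    unfolding q_def by (intro sum.cong refl) (simp add: Aij mult.commute mult.left_commute)
  finally have "q \<in> \<real>" by (simp add: Reals_cnj_iff)
  moreover have "s \<noteq> 0"
  proof
    assume "s = 0"
    then have "\<forall>i\<in>{..<N}. (cmod (v $ i))\<^sup>2 = 0"
      unfolding s_def by (subst (asm) sum_nonneg_eq_0_iff) auto
    then have "v = 0\<^sub>v N" using v(1) by (intro eq_vecI) auto
    then show False using v(2) by simp
  qed
  ultimately show ?thesis
    unfolding q by (metis Reals_divide Reals_of_real nonzero_mult_div_cancel_right of_real_eq_0_iff)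
qed

text \<open>Factor over the complex numbers, where all roots turn out real, and pull the
  factorization back along the injective embedding of coefficients.\<close>

lemma real_symmetric_char_poly_splits:
  fixes A :: "real Matrix.mat"
  assumes A: "A \<in> carrier_mat N N" and sym: "A\<^sup>T = A"
  shows "\<exists>es. char_poly A = (\<Prod>e\<leftarrow>es. [:- e, 1:]) \<and> length es = N"
proof -
  let ?C = "map_mat complex_of_real A"
  have C: "?C \<in> carrier_mat N N" using A by simp
  obtain as where as: "char_poly ?C = (\<Prod>a\<leftarrow>as. [:- a, 1:])" "length as = N"
    using char_poly_factorized[OF C] by blast
  have real: "a \<in> \<real>" if "a \<in> set as" for a
  proof (rule real_symmetric_root_real[OF A sym])
    show "poly (char_poly ?C) a = 0"
      using that unfolding as(1) by (auto simp: poly_prod_list prod_list_zero_iff image_iff intro!: bexI[of _ a])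
  qed
  interpret h: map_poly_inj_idom_hom "complex_of_real" ..
  have "map_poly complex_of_real (char_poly A) = (\<Prod>a\<leftarrow>as. [:- a, 1:])"
    unfolding as(1)[symmetric] by (rule of_real_hom.char_poly_hom[OF A, symmetric])
  also have "map (\<lambda>a. [:- a, 1:]) as = map (\<lambda>a. map_poly complex_of_real [:- Re a, 1:]) as"
    using real by (intro map_cong refl) (auto simp: of_real_Re)
  also have "prod_list \<dots> = map_poly complex_of_real (\<Prod>e\<leftarrow>map Re as. [:- e, 1:])"
    by (simp add: h.hom_prod_list o_def)
  finally have "char_poly A = (\<Prod>e\<leftarrow>map Re as. [:- e, 1:])"
    by (simp only: h.eq_iff)
  then show ?thesis using as(2) by (intro exI[of _ "map Re as"]) simp
qed

text \<open>Ensures that the list inside \<open>lambda2\<close> holds all \<open>N\<close> roots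
  with multiplicity, so that for \<open>N \<ge> 2\<close> its entry 1 is a genuine second smallest
  eigenvalue.\<close>

lemma sorted_roots_real_symmetric:
  fixes A :: "real Matrix.mat"
  assumes A: "A \<in> carrier_mat N N" and sym: "A\<^sup>T = A"
  defines "es \<equiv> sorted_list_of_multiset (proots (char_poly A))"
  shows "char_poly A = (\<Prod>e\<leftarrow>es. [:- e, 1:])" and "length es = N" and "sorted es"
proof -
  obtain fs where fs: "char_poly A = (\<Prod>e\<leftarrow>fs. [:- e, 1:])" "length fs = N"
    using real_symmetric_char_poly_splits[OF A sym] by blast
  have "proots (\<Prod>e\<leftarrow>gs. [:- e, 1:]) = mset gs" for gs :: "real list"
  proof (induction gs)
    case (Cons g gs)
    have "(\<Prod>e\<leftarrow>gs. [:- e, 1:]) \<noteq> 0" by (auto simp: prod_list_zero_iff)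
    then show ?case using Cons by (simp add: proots_mult del: mult_pCons_left)
  qed simp
  then have mset: "mset es = mset fs" using fs by (simp add: es_def)
  have "(\<Prod>e\<leftarrow>es. [:- e, 1:]) = prod_mset (image_mset (\<lambda>e. [:- e, 1:]) (mset es))"
    by (simp flip: prod_mset_prod_list)
  also have "\<dots> = (\<Prod>e\<leftarrow>fs. [:- e, 1:])"
    unfolding mset by (simp flip: prod_mset_prod_list)
  finally show "char_poly A = (\<Prod>e\<leftarrow>es. [:- e, 1:])" using fs by simp
  show "length es = N" using mset fs(2) by (metis size_mset)
  show "sorted es" by (simp add: es_def)
qed

text \<open>The first two columns of a Schur basis span an invariant plane, and symmetry makes the
  restriction to an orthogonal basis of it diagonal. This covers the case of a double eigenvalue
  without the full spectral theorem.\<close>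

lemma real_symmetric_two_eigenvectors:
  fixes A :: "real Matrix.mat"
  assumes A: "A \<in> carrier_mat N N" and sym: "A\<^sup>T = A" and N: "2 \<le> N"
    and cp: "char_poly A = (\<Prod>e\<leftarrow>es. [:- e, 1:])"
  obtains u v where "eigenvector A u (es ! 0)" "eigenvector A v (es ! 1)" "u \<bullet> v = 0"
proof -
  obtain B P Q where schur: "schur_decomposition A es = (B, P, Q)"
    by (cases "schur_decomposition A es") auto
  have sim: "similar_mat_wit A B P Q" and ut: "upper_triangular B" and diag: "diag_mat B = es"
    using schur_decomposition[OF A cp schur] by auto
  note D = similar_mat_witD2[OF A sim]
  have B: "B \<in> carrier_mat N N" and P: "P \<in> carrier_mat N N" and Q: "Q \<in> carrier_mat N N"
    using D by auto
  have AP: "A * P = P * B"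
  proof -
    have "P * B * Q * P = P * B * (Q * P)" using P B Q by (intro assoc_mult_mat) auto
    then show ?thesis using P B by (simp flip: D(3) add: D(2))
  qed
  have e: "B $$ (i, i) = es ! i" if "i < N" for i
    using that B by (simp flip: diag add: diag_mat_def)
  define b where "b = B $$ (0, 1)"
  define p0 where "p0 = col P 0"
  define p1 where "p1 = col P 1"
  have p: "p0 \<in> carrier_vec N" "p1 \<in> carrier_vec N" using P by (auto simp: p0_def p1_def)
  have AP_col: "A *\<^sub>v col P j = P *\<^sub>v col B j" if "j < N" for j
    using that A P B AP by (metis col_mult2)
  have PB: "(P *\<^sub>v col B j) $ i = (\<Sum>k<N. P $$ (i, k) * B $$ (k, j))" if "i < N" "j < N" for i j
    using that P B by (simp add: scalar_prod_def atLeast0LessThan)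
  have Ap0: "A *\<^sub>v p0 = es ! 0 \<cdot>\<^sub>v p0"
  proof (rule eq_vecI)
    fix i assume "i < dim_vec (es ! 0 \<cdot>\<^sub>v p0)"
    then have i: "i < N" using p by simp
    have "(\<Sum>k<N. P $$ (i, k) * B $$ (k, 0)) = (\<Sum>k<N. if k = 0 then P $$ (i, k) * es ! 0 else 0)"
      using ut B e[of 0] N by (intro sum.cong refl) (auto dest: upper_triangularD)
    then show "(A *\<^sub>v p0) $ i = (es ! 0 \<cdot>\<^sub>v p0) $ i"
      using i N P p PB[of i 0] AP_col[of 0] by (simp add: p0_def)
  qed (use A p in simp)
  have Ap1: "A *\<^sub>v p1 = b \<cdot>\<^sub>v p0 + es ! 1 \<cdot>\<^sub>v p1"
  proof (rule eq_vecI)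
    fix i assume "i < dim_vec (b \<cdot>\<^sub>v p0 + es ! 1 \<cdot>\<^sub>v p1)"
    then have i: "i < N" using p by simp
    have "(\<Sum>k<N. P $$ (i, k) * B $$ (k, 1)) = (\<Sum>k<N. (if k = 0 then P $$ (i, k) * b else 0) +
        (if k = 1 then P $$ (i, k) * es ! 1 else 0))"
      using upper_triangularD[OF ut, of 1] B e[of 1] N by (intro sum.cong refl) (auto simp: b_def)
    then show "(A *\<^sub>v p1) $ i = (b \<cdot>\<^sub>v p0 + es ! 1 \<cdot>\<^sub>v p1) $ i"
      using i N P p PB[of i 1] AP_col[of 1] by (simp add: p0_def p1_def sum.distrib)
  qed (use A p in simp)
  \<comment> \<open>\<open>Q\<close> inverts \<open>P\<close> and so maps the columns
    \<open>p0\<close> and \<open>p1\<close> to unit vectors; this will show that \<open>p0\<close>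
    and \<open>u\<close> are nonzero.\<close>
  have Qp: "Q *\<^sub>v p0 = unit_vec N 0" "Q *\<^sub>v p1 = unit_vec N 1"
  proof -
    have "Q *\<^sub>v col P j = unit_vec N j" if "j < N" for j
      using that P Q D(2) by (metis col_mult2 col_one)
    then show "Q *\<^sub>v p0 = unit_vec N 0" "Q *\<^sub>v p1 = unit_vec N 1"
      using N by (auto simp: p0_def p1_def)
  qed
  have p0: "p0 \<noteq> 0\<^sub>v N"
  proof
    assume "p0 = 0\<^sub>v N"
    then have "(Q *\<^sub>v p0) $ 0 = 0" using Q N by (simp add: scalar_prod_def)
    then show False using Qp(1) N by simp
  qed
  have pp: "p0 \<bullet> p0 \<noteq> 0"
    using conjugate_square_eq_0_vec[OF p(1)] p0 by (simp add: conjugate_vec_def vec_eq_iff)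
  \<comment> \<open>One Gram-Schmidt step: \<open>u\<close> is \<open>p1\<close> minus its
    projection onto \<open>p0\<close>.\<close>
  define s where "s = (p0 \<bullet> p1) / (p0 \<bullet> p0)"
  define u where "u = p1 + (- s) \<cdot>\<^sub>v p0"
  have u: "u \<in> carrier_vec N" using p by (simp add: u_def)
  have orth: "p0 \<bullet> u = 0"
    using p pp by (simp add: u_def s_def scalar_prod_add_distrib[of _ N] scalar_prod_smult_distrib[of _ N])
  have u0: "u \<noteq> 0\<^sub>v N"
  proof
    assume "u = 0\<^sub>v N"
    then have "(Q *\<^sub>v u) $ 1 = 0" using Q N by (simp add: scalar_prod_def)
    moreover have "Q *\<^sub>v u = unit_vec N 1 + (- s) \<cdot>\<^sub>v unit_vec N 0"
      using p Q unfolding u_def by (simp add: mult_add_distrib_mat_vec[of _ N N] mult_mat_vec[of _ N N] Qp)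
    ultimately show False using N by simp
  qed
  \<comment> \<open>The off-diagonal coefficient of \<open>A\<close> in the basis \<open>p0\<close>,
    \<open>u\<close>. It vanishes on comparing \<open>p0 \<bullet> A u = g (p0 \<bullet> p0)\<close>
    with \<open>A p0 \<bullet> u = 0\<close>.\<close>
  define g where "g = b + s * (es ! 1 - es ! 0)"
  have Au: "A *\<^sub>v u = g \<cdot>\<^sub>v p0 + es ! 1 \<cdot>\<^sub>v u"
  proof -
    have "A *\<^sub>v u = (b \<cdot>\<^sub>v p0 + es ! 1 \<cdot>\<^sub>v p1) + (- s) \<cdot>\<^sub>v (es ! 0 \<cdot>\<^sub>v p0)"
      using p A unfolding u_def by (simp add: mult_add_distrib_mat_vec[of _ N N] mult_mat_vec[of _ N N] Ap0 Ap1)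
    also have "\<dots> = g \<cdot>\<^sub>v p0 + es ! 1 \<cdot>\<^sub>v u"
      using p by (intro eq_vecI) (auto simp: u_def g_def algebra_simps)
    finally show ?thesis .
  qed
  have "p0 \<bullet> (A *\<^sub>v u) = (A *\<^sub>v p0) \<bullet> u"
    using transpose_vec_mult_scalar[OF A u p(1)] sym by simp
  also have "\<dots> = 0" using p u orth by (simp add: Ap0 smult_scalar_prod_distrib[of _ N])
  also have "p0 \<bullet> (A *\<^sub>v u) = g * (p0 \<bullet> p0)"
    using p u orth by (simp add: Au scalar_prod_add_distrib[of _ N] scalar_prod_smult_distrib[of _ N])
  finally have "g = 0" using pp by simp
  then have "A *\<^sub>v u = es ! 1 \<cdot>\<^sub>v u" using Au u p by auto
  then have "eigenvector A u (es ! 1)" using u u0 A by (simp add: eigenvector_def)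
  moreover have "eigenvector A p0 (es ! 0)" using p p0 A Ap0 by (simp add: eigenvector_def)
  ultimately show ?thesis using that orth by blast
qed

text \<open>One half of Courant-Fischer. If \<open>lambda2 A \<le> t\<close>, two orthogonal
  eigenvectors with eigenvalues at most \<open>t\<close> span a plane, which meets the hyperplane
  orthogonal to \<open>c\<close> in a nonzero vector; its Rayleigh quotient is at most
  \<open>t\<close>, a contradiction.\<close>

lemma lambda2_greater:
  fixes A :: "real Matrix.mat"
  assumes A: "A \<in> carrier_mat N N" and sym: "A\<^sup>T = A" and N: "2 \<le> N"
    and c: "c \<in> carrier_vec N"
    and pos: "\<And>x. x \<in> carrier_vec N \<Longrightarrow> x \<noteq> 0\<^sub>v N \<Longrightarrow> c \<bullet> x = 0 \<Longrightarrow> x \<bullet> (A *\<^sub>v x) > t * (x \<bullet> x)"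
  shows "lambda2 A > t"
proof (rule ccontr)
  define es where "es = sorted_list_of_multiset (proots (char_poly A))"
  note es = sorted_roots_real_symmetric[OF A sym, folded es_def]
  assume "\<not> t < lambda2 A"
  then have e1: "es ! 1 \<le> t" by (simp add: lambda2_def es_def)
  have e0: "es ! 0 \<le> t"
    using sorted_nth_mono[OF es(3), of 0 1] es(2) N e1 by simp
  obtain u v where "eigenvector A u (es ! 0)" "eigenvector A v (es ! 1)" and uv: "u \<bullet> v = 0"
    using real_symmetric_two_eigenvectors[OF A sym N es(1)] by blast
  then have u: "u \<in> carrier_vec N" "u \<noteq> 0\<^sub>v N" "A *\<^sub>v u = es ! 0 \<cdot>\<^sub>v u"
    and v: "v \<in> carrier_vec N" "v \<noteq> 0\<^sub>v N" "A *\<^sub>v v = es ! 1 \<cdot>\<^sub>v v"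
    using A by (auto simp: eigenvector_def)
  have vu: "v \<bullet> u = 0" using uv comm_scalar_prod[OF u(1) v(1)] by simp
  have sq: "x \<bullet> x \<ge> 0" "x \<noteq> 0\<^sub>v N \<Longrightarrow> x \<bullet> x > 0" if "x \<in> carrier_vec N" for x :: "real Matrix.vec"
  proof -
    have "conjugate x = x" by (simp add: vec_eq_iff)
    then show "x \<bullet> x \<ge> 0" "x \<noteq> 0\<^sub>v N \<Longrightarrow> x \<bullet> x > 0"
      using conjugate_square_ge_0_vec[of x] conjugate_square_greater_0_vec[OF that] by auto
  qed
  \<comment> \<open>Coefficients solving
    \<open>\<alpha> (c \<bullet> u) + \<beta> (c \<bullet> v) = 0\<close> that are not both zero; if
    \<open>c \<bullet> u = 0\<close>, the vector \<open>u\<close> itself is taken.\<close>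
  define \<alpha> where "\<alpha> = (if c \<bullet> u = 0 then 1 else c \<bullet> v)"
  define \<beta> where "\<beta> = (if c \<bullet> u = 0 then 0 else - (c \<bullet> u))"
  define x where "x = \<alpha> \<cdot>\<^sub>v u + \<beta> \<cdot>\<^sub>v v"
  have x: "x \<in> carrier_vec N" using u v by (simp add: x_def)
  note simps = scalar_prod_add_distrib[of _ N] add_scalar_prod_distrib[of _ N]
    scalar_prod_smult_distrib[of _ N] smult_scalar_prod_distrib[of _ N]
  have xx: "x \<bullet> x = \<alpha>\<^sup>2 * (u \<bullet> u) + \<beta>\<^sup>2 * (v \<bullet> v)"
    using u v unfolding x_def by (simp add: simps uv vu power2_eq_square)
  have "A *\<^sub>v x = (\<alpha> * es ! 0) \<cdot>\<^sub>v u + (\<beta> * es ! 1) \<cdot>\<^sub>v v"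
    using u v A unfolding x_def
    by (simp add: mult_add_distrib_mat_vec[of _ N N] mult_mat_vec[of _ N N] smult_smult_assoc)
  then have xAx: "x \<bullet> (A *\<^sub>v x) = es ! 0 * (\<alpha>\<^sup>2 * (u \<bullet> u)) + es ! 1 * (\<beta>\<^sup>2 * (v \<bullet> v))"
    using u v unfolding x_def by (simp add: simps uv vu power2_eq_square)
  have "\<alpha> \<noteq> 0 \<or> \<beta> \<noteq> 0" by (auto simp: \<alpha>_def \<beta>_def)
  then have "x \<bullet> x > 0"
    unfolding xx using sq[OF u(1)] sq[OF v(1)] u(2) v(2)
    by (auto intro: add_pos_nonneg add_nonneg_pos)
  then have "x \<noteq> 0\<^sub>v N" by (auto simp: scalar_prod_def)
  moreover have "c \<bullet> x = 0"
    using u v c unfolding x_def by (simp add: simps \<alpha>_def \<beta>_def)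
  ultimately have "x \<bullet> (A *\<^sub>v x) > t * (x \<bullet> x)" using pos x by blast
  moreover have "x \<bullet> (A *\<^sub>v x) \<le> t * (x \<bullet> x)"
    unfolding xAx xx distrib_left using e0 e1 sq[OF u(1)] sq[OF v(1)]
    by (intro add_mono mult_right_mono) auto
  ultimately show False by simp
qed

section \<open>The link graph\<close>

lemma letter_inv_less: "v < 2 * n \<Longrightarrow> letter_inv n v < 2 * n"
  by (auto simp: letter_inv_def)

lemma letter_inv_letter_inv: "v < 2 * n \<Longrightarrow> letter_inv n (letter_inv n v) = v"
  by (auto simp: letter_inv_def)

lemma letter_inv_neq: "v < 2 * n \<Longrightarrow> letter_inv n v \<noteq> v"
  by (auto simp: letter_inv_def)

lemma letter_inv_eq_iff:
  "v < 2 * n \<Longrightarrow> w < 2 * n \<Longrightarrow> letter_inv n v = letter_inv n w \<longleftrightarrow> v = w"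
  by (auto simp: letter_inv_def split: if_splits)

lemma finite_tri_words: "finite (tri_words n)"
  by (rule finite_subset[of _ "{..<2 * n} \<times> {..<2 * n} \<times> {..<2 * n}"]) (auto simp: tri_words_def)

lemma sum_of_bool_eq:
  fixes g :: "nat \<Rightarrow> real"
  assumes "u < N"
  shows "(\<Sum>w<N. of_bool (w = u) * g w) = g u" "(\<Sum>w<N. of_bool (u = w) * g w) = g u"
proof -
  have "(\<Sum>w<N. of_bool (w = u) * g w) = (\<Sum>w<N. if w = u then g w else 0)"
    by (intro sum.cong) auto
  then show "(\<Sum>w<N. of_bool (w = u) * g w) = g u" using assms by simp
  have "(\<Sum>w<N. of_bool (u = w) * g w) = (\<Sum>w<N. if w = u then g w else 0)"
    by (intro sum.cong) auto
  then show "(\<Sum>w<N. of_bool (u = w) * g w) = g u" using assms by simp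
qed

lemma sum_letter_inv: "(\<Sum>v<2 * n. g (letter_inv n v)) = (\<Sum>v<2 * n. g v)" for g :: "nat \<Rightarrow> real"
  by (rule sum.reindex_bij_witness[of _ "letter_inv n" "letter_inv n"])
    (auto simp: letter_inv_less letter_inv_letter_inv)

text \<open>Adjacency, degree and quadratic form of a relator all have this shape, so their totals
  over all words follow from one computation with general \<open>h\<close>.\<close>

definition edge_sum :: "nat \<Rightarrow> (nat \<Rightarrow> nat \<Rightarrow> real) \<Rightarrow> nat \<times> nat \<times> nat \<Rightarrow> real" where
  "edge_sum n h r = (\<Sum>(x, y)\<leftarrow>link_edges n r. h x y)"

lemma edge_sum_simp:
  "edge_sum n h (a, b, c) = h a (letter_inv n b) + h b (letter_inv n c) + h c (letter_inv n a)"
  by (simp add: edge_sum_def link_edges_def)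

lemma edge_sum_cong:
  assumes "r \<in> tri_words n" "\<And>x y. x < 2 * n \<Longrightarrow> y < 2 * n \<Longrightarrow> x \<noteq> y \<Longrightarrow> h x y = h' x y"
  shows "edge_sum n h r = edge_sum n h' r"
  using assms by (cases r) (auto simp: edge_sum_simp tri_words_def letter_inv_less)

lemma edge_sum_le:
  assumes "r \<in> tri_words n" "\<And>x y. x < 2 * n \<Longrightarrow> y < 2 * n \<Longrightarrow> x \<noteq> y \<Longrightarrow> h x y \<le> C"
  shows "edge_sum n h r \<le> 3 * C"
proof -
  obtain a b c where r: "r = (a, b, c)" by (cases r)
  have "h a (letter_inv n b) \<le> C" "h b (letter_inv n c) \<le> C" "h c (letter_inv n a) \<le> C"
    using assms unfolding r by (auto simp: tri_words_def letter_inv_less)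
  then show ?thesis by (simp add: r edge_sum_simp)
qed

lemma edge_sum_nonneg: "(\<And>x y. 0 \<le> h x y) \<Longrightarrow> 0 \<le> edge_sum n h r"
  by (cases r) (simp add: edge_sum_simp)

lemma sum_edge_sum: "(\<Sum>i\<in>I. edge_sum n (h i) r) = edge_sum n (\<lambda>x y. \<Sum>i\<in>I. h i x y) r"
  by (cases r) (simp add: edge_sum_simp sum.distrib)

lemma edge_sum_mult_right: "edge_sum n h r * c = edge_sum n (\<lambda>x y. h x y * c) r"
  by (cases r) (simp add: edge_sum_simp algebra_simps)

text \<open>In a word with first edge \<open>(x, y)\<close> the second letter is the inverse of
  \<open>y\<close>, and the third must avoid \<open>y\<close> and the inverse of \<open>x\<close>.
  These two coincide exactly if \<open>y = letter_inv n x\<close>, whence the correction.\<close>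

lemma sum_third_letter:
  assumes "x < 2 * n" "y < 2 * n"
  shows "(\<Sum>c<2 * n. of_bool (c \<noteq> y \<and> c \<noteq> letter_inv n x)) =
    (2 * real n - 2 + of_bool (y = letter_inv n x) :: real)"
proof -
  have "(\<Sum>c<2 * n. of_bool (c \<noteq> y \<and> c \<noteq> letter_inv n x) :: real) =
    (\<Sum>c<2 * n. 1 - of_bool (c = y) * 1 - of_bool (c = letter_inv n x) * 1
      + of_bool (c = y) * of_bool (y = letter_inv n x))"
    by (intro sum.cong) auto
  also have "\<dots> = 2 * real n - 2 + of_bool (y = letter_inv n x)"
    using assms by (simp only: sum.distrib sum_subtractf sum_of_bool_eq letter_inv_less) simp
  finally show ?thesis .
qed

text \<open>An ordered pair \<open>(x, y)\<close> is the first edge of no word if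
  \<open>x = y\<close>, of \<open>2 n - 1\<close> words if \<open>y\<close> is the inverse of
  \<open>x\<close>, and of \<open>2 n - 2\<close> words otherwise.\<close>

lemma sum_tri_words_first_edge:
  "(\<Sum>(a, b, c)\<in>tri_words n. h a (letter_inv n b)) =
    (2 * real n - 2) * ((\<Sum>x<2 * n. \<Sum>y<2 * n. h x y) - (\<Sum>x<2 * n. h x x)) +
    (\<Sum>x<2 * n. h x (letter_inv n x))" (is "?L = _")
proof -
  let ?V = "{..<2 * n}"
  let ?good = "\<lambda>x y c. x \<noteq> y \<and> c \<noteq> y \<and> c \<noteq> letter_inv n x"
  have "?L = (\<Sum>(x, y, c)\<in>{(x, y, c). (x, y, c) \<in> ?V \<times> ?V \<times> ?V \<and> ?good x y c}. h x y)"
    by (rule sum.reindex_bij_witness[of _ "\<lambda>(x, y, c). (x, letter_inv n y, c)" "\<lambda>(x, y, c). (x, letter_inv n y, c)"])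
      (auto simp: tri_words_def letter_inv_less letter_inv_letter_inv letter_inv_eq_iff)
  also have "\<dots> = (\<Sum>(x, y, c)\<in>?V \<times> ?V \<times> ?V. of_bool (?good x y c) * h x y)"
    by (rule sum.mono_neutral_cong_left) auto
  also have "\<dots> = (\<Sum>x<2 * n. \<Sum>y<2 * n. \<Sum>c<2 * n. of_bool (?good x y c) * h x y)"
    by (simp only: sum.cartesian_product case_prod_unfold fst_conv snd_conv)
  also have "\<dots> = (\<Sum>x<2 * n. \<Sum>y<2 * n.
      (2 * real n - 2) * h x y - of_bool (x = y) * ((2 * real n - 2) * h x y) + of_bool (y = letter_inv n x) * h x y)"
  proof (intro sum.cong refl)
    fix x y assume xy: "x \<in> ?V" "y \<in> ?V"
    have "(\<Sum>c<2 * n. of_bool (?good x y c) * h x y) =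
      of_bool (x \<noteq> y) * h x y * (\<Sum>c<2 * n. of_bool (c \<noteq> y \<and> c \<noteq> letter_inv n x))"
      unfolding sum_distrib_left by (intro sum.cong) auto
    also have "\<dots> = of_bool (x \<noteq> y) * h x y * (2 * real n - 2 + of_bool (y = letter_inv n x))"
      using xy by (simp only: sum_third_letter lessThan_iff)
    also have "\<dots> = (2 * real n - 2) * h x y - of_bool (x = y) * ((2 * real n - 2) * h x y)
        + of_bool (y = letter_inv n x) * h x y"
      using xy letter_inv_neq[of x n] by (cases "x = y") (auto simp: algebra_simps)
    finally show "(\<Sum>c<2 * n. of_bool (?good x y c) * h x y) = \<dots>" .
  qed
  also have "\<dots> = (2 * real n - 2) * ((\<Sum>x<2 * n. \<Sum>y<2 * n. h x y) - (\<Sum>x<2 * n. h x x)) +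
    (\<Sum>x<2 * n. h x (letter_inv n x))"
  proof -
    have 1: "(\<Sum>x<2 * n. \<Sum>y<2 * n. of_bool (x = y) * ((2 * real n - 2) * h x y)) =
        (\<Sum>x<2 * n. (2 * real n - 2) * h x x)"
      by (intro sum.cong refl sum_of_bool_eq) auto
    have 2: "(\<Sum>x<2 * n. \<Sum>y<2 * n. of_bool (y = letter_inv n x) * h x y) =
        (\<Sum>x<2 * n. h x (letter_inv n x))"
      by (intro sum.cong refl sum_of_bool_eq) (auto simp: letter_inv_less)
    show ?thesis
      unfolding sum.distrib sum_subtractf 1 2 sum_distrib_left[symmetric] by (simp only: right_diff_distrib)
  qed
  finally show ?thesis .
qed

text \<open>Cyclic rotation permutes \<open>tri_words n\<close> and brings the second or third edge
  to the front, so all three positions contribute equally.\<close>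

lemma sum_tri_words_edge_sum:
  "(\<Sum>r\<in>tri_words n. edge_sum n h r) =
    3 * ((2 * real n - 2) * ((\<Sum>x<2 * n. \<Sum>y<2 * n. h x y) - (\<Sum>x<2 * n. h x x)) +
    (\<Sum>x<2 * n. h x (letter_inv n x)))"
proof -
  let ?S = "\<Sum>(a, b, c)\<in>tri_words n. h a (letter_inv n b)"
  have 1: "(\<Sum>(a, b, c)\<in>tri_words n. h b (letter_inv n c)) = ?S"
    by (rule sum.reindex_bij_witness[of _ "\<lambda>(a, b, c). (c, a, b)" "\<lambda>(a, b, c). (b, c, a)"])
      (auto simp: tri_words_def)
  have 2: "(\<Sum>(a, b, c)\<in>tri_words n. h c (letter_inv n a)) = ?S"
    by (rule sum.reindex_bij_witness[of _ "\<lambda>(a, b, c). (b, c, a)" "\<lambda>(a, b, c). (c, a, b)"])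
      (auto simp: tri_words_def)
  have "(\<Sum>r\<in>tri_words n. edge_sum n h r) =
      (\<Sum>r\<in>tri_words n. (case r of (a, b, c) \<Rightarrow> h a (letter_inv n b)) +
        (case r of (a, b, c) \<Rightarrow> h b (letter_inv n c)) + (case r of (a, b, c) \<Rightarrow> h c (letter_inv n a)))"
    by (intro sum.cong refl) (auto simp: edge_sum_simp)
  also have "\<dots> = 3 * ?S"
    unfolding sum.distrib 1 2 by simp
  finally show ?thesis by (simp only: sum_tri_words_first_edge)
qed

section \<open>Adjacency and degree contributions of a single relator\<close>

definition rel_adj :: "nat \<Rightarrow> nat \<times> nat \<times> nat \<Rightarrow> nat \<Rightarrow> nat \<Rightarrow> real" where
  "rel_adj n r v w = edge_sum n (\<lambda>x y. of_bool (x = v \<and> y = w \<or> x = w \<and> y = v)) r"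

definition rel_deg :: "nat \<Rightarrow> nat \<times> nat \<times> nat \<Rightarrow> nat \<Rightarrow> real" where
  "rel_deg n r v = edge_sum n (\<lambda>x y. of_bool (x = v) + of_bool (y = v)) r"

definition rel_mat :: "nat \<Rightarrow> nat \<times> nat \<times> nat \<Rightarrow> nat \<Rightarrow> nat \<Rightarrow> real" where
  "rel_mat n r v w = of_bool (v = w) * rel_deg n r v / 2 - rel_adj n r v w"

lemma real_length_filter: "real (length (filter P xs)) = (\<Sum>x\<leftarrow>xs. of_bool (P x))"
  by (induction xs) auto

lemma real_link_adj: "real (link_adj n R v w) = (\<Sum>r\<in>R. rel_adj n r v w)"
  unfolding link_adj_def of_nat_sum real_length_filter rel_adj_def edge_sum_def
  by (simp add: case_prod_unfold)

lemma rel_adj_nonneg: "0 \<le> rel_adj n r v w"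
  unfolding rel_adj_def by (rule edge_sum_nonneg) simp

lemma rel_deg_nonneg: "0 \<le> rel_deg n r v"
  unfolding rel_deg_def by (rule edge_sum_nonneg) simp

lemma rel_adj_commute: "rel_adj n r v w = rel_adj n r w v"
  unfolding rel_adj_def by (rule arg_cong[where f = "\<lambda>h. edge_sum n h r"])
    (intro ext arg_cong[where f = of_bool], blast)

lemma sum_of_bool_edge:
  fixes g :: "nat \<Rightarrow> real"
  assumes "x < N" "y < N" "x \<noteq> y"
  shows "(\<Sum>w<N. of_bool (x = v \<and> y = w \<or> x = w \<and> y = v) * g w) = of_bool (x = v) * g y + of_bool (y = v) * g x"
proof -
  have "(\<Sum>w<N. of_bool (x = v \<and> y = w \<or> x = w \<and> y = v) * g w) =
      (\<Sum>w<N. of_bool (y = w) * (of_bool (x = v) * g w) + of_bool (x = w) * (of_bool (y = v) * g w))"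
    using assms(3) by (intro sum.cong refl) auto
  then show ?thesis
    unfolding sum.distrib sum_of_bool_eq(2)[OF assms(1)] sum_of_bool_eq(2)[OF assms(2)] .
qed

lemma sum_rel_adj:
  assumes "r \<in> tri_words n"
  shows "(\<Sum>w<2 * n. rel_adj n r v w) = rel_deg n r v"
  unfolding rel_adj_def rel_deg_def sum_edge_sum
proof (rule edge_sum_cong[OF assms])
  fix x y assume xy: "x < 2 * n" "y < 2 * n" "x \<noteq> y"
  show "(\<Sum>w<2 * n. of_bool (x = v \<and> y = w \<or> x = w \<and> y = v)) = (of_bool (x = v) + of_bool (y = v) :: real)"
    using sum_of_bool_edge[OF xy, of v "\<lambda>_. 1"] by (simp only: mult_1_right)
qed

lemma real_link_deg:
  assumes "R \<subseteq> tri_words n"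
  shows "real (link_deg n R v) = (\<Sum>r\<in>R. rel_deg n r v)"
proof -
  have "real (link_deg n R v) = (\<Sum>r\<in>R. \<Sum>w<2 * n. rel_adj n r v w)"
    unfolding link_deg_def of_nat_sum real_link_adj by (rule sum.swap)
  also have "\<dots> = (\<Sum>r\<in>R. rel_deg n r v)"
    using assms by (intro sum.cong refl sum_rel_adj) auto
  finally show ?thesis .
qed

lemma symmetric_rel_mat: "rel_mat n r v w = rel_mat n r w v"
  using rel_adj_commute[of n r v w] by (cases "v = w") (simp_all add: rel_mat_def)

text \<open>The diagonal term costs half the degree, and the adjacency entries sum to the
  degree.\<close>

lemma abs_rel_mat_column_sum_le:
  assumes "r \<in> tri_words n" "u < 2 * n"
  shows "(\<Sum>v<2 * n. \<bar>rel_mat n r v u\<bar>) \<le> 3 / 2 * rel_deg n r u"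
proof -
  have "(\<Sum>v<2 * n. \<bar>rel_mat n r v u\<bar>) \<le> (\<Sum>v<2 * n. of_bool (v = u) * (rel_deg n r v / 2) + rel_adj n r u v)"
  proof (rule sum_mono)
    fix v
    show "\<bar>rel_mat n r v u\<bar> \<le> of_bool (v = u) * (rel_deg n r v / 2) + rel_adj n r u v"
      using rel_adj_nonneg[of n r u v] rel_deg_nonneg[of n r v] rel_adj_commute[of n r v u]
      by (cases "v = u") (simp_all add: rel_mat_def)
  qed
  also have "\<dots> = rel_deg n r u / 2 + rel_deg n r u"
    using assms by (simp only: sum.distrib sum_of_bool_eq sum_rel_adj)
  finally show ?thesis by simp
qed

text \<open>Each of the three edges has distinct ends, so it meets \<open>u\<close> at most
  once.\<close>

lemma rel_deg_le:
  assumes "r \<in> tri_words n"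
  shows "rel_deg n r u \<le> 3"
  unfolding rel_deg_def by (rule order.trans[OF edge_sum_le[OF assms, where C = 1]]) auto

lemma sum_rel_deg:
  assumes "u < 2 * n"
  shows "(\<Sum>r\<in>tri_words n. rel_deg n r u) = 6 * ((2 * real n - 2) * (2 * real n - 1) + 1)"
proof -
  have 1: "(\<Sum>v<2 * n. of_bool (v = u) :: real) = 1"
    using sum_of_bool_eq(1)[OF assms, of "\<lambda>_. 1"] by (simp only: mult_1_right)
  have 2: "(\<Sum>v<2 * n. of_bool (letter_inv n v = u) :: real) = 1"
    by (rule trans[OF sum_letter_inv 1])
  have 3: "(\<Sum>x<2 * n. \<Sum>y<2 * n. of_bool (x = u) :: real) = 2 * real n"
    by (subst sum.swap) (simp only: 1 sum_constant card_lessThan of_nat_mult of_nat_numeral mult_1_right)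
  show ?thesis
    unfolding rel_deg_def sum_tri_words_edge_sum sum.distrib 1 2 3
    by (simp add: algebra_simps)
qed

text \<open>Supplies the cost \<open>B\<close> of a new letter: the total degree of a vertex over
  all words is \<open>24 n^2\<close> to leading order, and \<open>3 / 2\<close> of it is
  taken.\<close>

lemma sum_abs_rel_mat_column_sum_le:
  assumes "u < 2 * n"
  shows "(\<Sum>r\<in>tri_words n. \<Sum>v<2 * n. \<bar>rel_mat n r v u\<bar>) \<le> 36 * (real n)\<^sup>2"
proof -
  have "(\<Sum>r\<in>tri_words n. \<Sum>v<2 * n. \<bar>rel_mat n r v u\<bar>) \<le> (\<Sum>r\<in>tri_words n. 3 / 2 * rel_deg n r u)"
    using assms by (intro sum_mono abs_rel_mat_column_sum_le)
  also have "\<dots> = 9 * ((2 * real n - 2) * (2 * real n - 1) + 1)"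
    unfolding sum_distrib_left[symmetric] sum_rel_deg[OF assms] by simp
  also have "\<dots> \<le> 36 * (real n)\<^sup>2"
    using assms by (simp add: algebra_simps power2_eq_square)
  finally show ?thesis .
qed

lemma quad_form_rel_mat:
  "quad_form (2 * n) (rel_mat n r) x =
    (\<Sum>v<2 * n. rel_deg n r v * ((x v)\<^sup>2 / 2)) - (\<Sum>v<2 * n. \<Sum>w<2 * n. rel_adj n r v w * (x v * x w))"
proof -
  have "quad_form (2 * n) (rel_mat n r) x =
      (\<Sum>v<2 * n. \<Sum>w<2 * n. of_bool (v = w) * (rel_deg n r v / 2 * x v * x w)) -
      (\<Sum>v<2 * n. \<Sum>w<2 * n. rel_adj n r v w * (x v * x w))"
    unfolding quad_form_def rel_mat_def sum_subtractf[symmetric] by (intro sum.cong refl) (simp add: algebra_simps)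
  also have "(\<Sum>v<2 * n. \<Sum>w<2 * n. of_bool (v = w) * (rel_deg n r v / 2 * x v * x w)) =
      (\<Sum>v<2 * n. rel_deg n r v * ((x v)\<^sup>2 / 2))"
  proof (rule sum.cong[OF refl])
    fix v assume "v \<in> {..<2 * n}"
    then show "(\<Sum>w<2 * n. of_bool (v = w) * (rel_deg n r v / 2 * x v * x w)) = rel_deg n r v * ((x v)\<^sup>2 / 2)"
      by (subst sum_of_bool_eq) (simp_all add: power2_eq_square)
  qed
  finally show ?thesis .
qed

lemma quad_form_rel_mat_eq_edge_sum:
  assumes "r \<in> tri_words n"
  shows "quad_form (2 * n) (rel_mat n r) x =
    edge_sum n (\<lambda>v w. (x v)\<^sup>2 / 2 + (x w)\<^sup>2 / 2 - 2 * x v * x w) r"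
proof -
  have "(\<Sum>v<2 * n. rel_deg n r v * ((x v)\<^sup>2 / 2)) = edge_sum n (\<lambda>v w. (x v)\<^sup>2 / 2 + (x w)\<^sup>2 / 2) r"
    unfolding rel_deg_def edge_sum_mult_right sum_edge_sum
  proof (rule edge_sum_cong[OF assms])
    fix a b assume ab: "a < 2 * n" "b < 2 * n"
    show "(\<Sum>v<2 * n. (of_bool (a = v) + of_bool (b = v)) * ((x v)\<^sup>2 / 2)) = (x a)\<^sup>2 / 2 + (x b)\<^sup>2 / 2"
      unfolding distrib_right sum.distrib sum_of_bool_eq(2)[OF ab(1)] sum_of_bool_eq(2)[OF ab(2)] ..
  qed
  moreover have "(\<Sum>v<2 * n. \<Sum>w<2 * n. rel_adj n r v w * (x v * x w)) =
      edge_sum n (\<lambda>v w. 2 * x v * x w) r"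
    unfolding rel_adj_def edge_sum_mult_right sum_edge_sum
  proof (rule edge_sum_cong[OF assms])
    fix a b assume ab: "a < 2 * n" "b < 2 * n" "a \<noteq> b"
    have "(\<Sum>v<2 * n. \<Sum>w<2 * n. of_bool (a = v \<and> b = w \<or> a = w \<and> b = v) * (x v * x w)) =
      (\<Sum>v<2 * n. of_bool (a = v) * (x v * x b) + of_bool (b = v) * (x v * x a))"
      unfolding sum_of_bool_edge[OF ab] by (simp add: mult.commute)
    also have "\<dots> = 2 * x a * x b"
      unfolding sum.distrib sum_of_bool_eq(2)[OF ab(1)] sum_of_bool_eq(2)[OF ab(2)] by simp
    finally show "(\<Sum>v<2 * n. \<Sum>w<2 * n. of_bool (a = v \<and> b = w \<or> a = w \<and> b = v) * (x v * x w)) =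
      2 * x a * x b" .
  qed
  ultimately show ?thesis by (cases r) (simp add: quad_form_rel_mat edge_sum_simp)
qed

text \<open>The deterministic part, up to the factor \<open>p\<close>. On the diagonal the edge
  function is \<open>- (x v)\<^sup>2\<close>, so removing the diagonal turns \<open>2 n\<close> into
  \<open>2 n + 1\<close>; the last bracket comes from edges joining a letter to its inverse.\<close>

lemma sum_quad_form_rel_mat:
  "(\<Sum>r\<in>tri_words n. quad_form (2 * n) (rel_mat n r) x) =
    3 * ((2 * real n - 2) * ((2 * real n + 1) * (\<Sum>v<2 * n. (x v)\<^sup>2) - 2 * (\<Sum>v<2 * n. x v)\<^sup>2)
      + ((\<Sum>v<2 * n. (x v)\<^sup>2) - 2 * (\<Sum>v<2 * n. x v * x (letter_inv n v))))"
proof -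
  let ?h = "\<lambda>v w. (x v)\<^sup>2 / 2 + (x w)\<^sup>2 / 2 - 2 * x v * x w"
  let ?S = "\<Sum>v<2 * n. (x v)\<^sup>2"
  have "(\<Sum>v<2 * n. \<Sum>w<2 * n. 2 * x v * x w) = 2 * (\<Sum>v<2 * n. x v)\<^sup>2"
    unfolding power2_eq_square sum_product by (simp add: sum_distrib_left mult.assoc)
  then have 1: "(\<Sum>v<2 * n. \<Sum>w<2 * n. ?h v w) = 2 * real n * ?S - 2 * (\<Sum>v<2 * n. x v)\<^sup>2"
    by (simp add: sum.distrib sum_subtractf sum_distrib_left[symmetric] sum_divide_distrib[symmetric])
  have 2: "(\<Sum>v<2 * n. ?h v v) = - ?S"
    unfolding sum_negf[symmetric] by (intro sum.cong refl) (simp add: power2_eq_square)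
  have "(\<Sum>v<2 * n. 2 * x v * x (letter_inv n v)) = 2 * (\<Sum>v<2 * n. x v * x (letter_inv n v))"
    by (simp add: sum_distrib_left mult.assoc)
  then have 3: "(\<Sum>v<2 * n. ?h v (letter_inv n v)) = ?S - 2 * (\<Sum>v<2 * n. x v * x (letter_inv n v))"
    using sum_letter_inv[of "\<lambda>v. (x v)\<^sup>2 / 2" n]
    by (simp add: sum.distrib sum_subtractf sum_divide_distrib[symmetric])
  have "(\<Sum>r\<in>tri_words n. quad_form (2 * n) (rel_mat n r) x) = (\<Sum>r\<in>tri_words n. edge_sum n ?h r)"
    by (intro sum.cong refl quad_form_rel_mat_eq_edge_sum)
  then show ?thesis
    unfolding sum_tri_words_edge_sum 1 2 3 by (simp add: algebra_simps)
qed

section \<open>Summation over the chosen relators and passage to the Laplacian\<close>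

lemma quad_form_sum:
  "quad_form N (\<lambda>v w. \<Sum>r\<in>T. c r * G r v w) x = (\<Sum>r\<in>T. c r * quad_form N (G r) x)"
proof -
  have "quad_form N (\<lambda>v w. \<Sum>r\<in>T. c r * G r v w) x =
      (\<Sum>v<N. \<Sum>w<N. \<Sum>r\<in>T. c r * (G r v w * x v * x w))"
    unfolding quad_form_def sum_distrib_right by (simp only: mult.assoc)
  also have "\<dots> = (\<Sum>v<N. \<Sum>r\<in>T. \<Sum>w<N. c r * (G r v w * x v * x w))"
    by (intro sum.cong refl sum.swap)
  also have "\<dots> = (\<Sum>r\<in>T. \<Sum>v<N. \<Sum>w<N. c r * (G r v w * x v * x w))"
    by (rule sum.swap)
  finally show ?thesis by (simp only: quad_form_def sum_distrib_left)
qed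

lemma sum_quad_form_relators:
  assumes R: "R \<subseteq> tri_words n"
  shows "(\<Sum>r\<in>R. quad_form (2 * n) (rel_mat n r) x) =
    (\<Sum>v<2 * n. real (link_deg n R v) * ((x v)\<^sup>2 / 2)) -
    (\<Sum>v<2 * n. \<Sum>w<2 * n. real (link_adj n R v w) * (x v * x w))"
proof -
  have "(\<Sum>r\<in>R. \<Sum>v<2 * n. rel_deg n r v * ((x v)\<^sup>2 / 2)) =
      (\<Sum>v<2 * n. real (link_deg n R v) * ((x v)\<^sup>2 / 2))"
    unfolding real_link_deg[OF R] sum_distrib_right by (rule sum.swap)
  moreover have "(\<Sum>r\<in>R. \<Sum>v<2 * n. \<Sum>w<2 * n. rel_adj n r v w * (x v * x w)) =
      (\<Sum>v<2 * n. \<Sum>w<2 * n. real (link_adj n R v w) * (x v * x w))"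
  proof -
    have "(\<Sum>r\<in>R. \<Sum>v<2 * n. \<Sum>w<2 * n. rel_adj n r v w * (x v * x w)) =
        (\<Sum>v<2 * n. \<Sum>r\<in>R. \<Sum>w<2 * n. rel_adj n r v w * (x v * x w))"
      by (rule sum.swap)
    also have "\<dots> = (\<Sum>v<2 * n. \<Sum>w<2 * n. \<Sum>r\<in>R. rel_adj n r v w * (x v * x w))"
      by (intro sum.cong refl sum.swap)
    finally show ?thesis by (simp only: real_link_adj sum_distrib_right)
  qed
  ultimately show ?thesis by (simp only: quad_form_rel_mat sum_subtractf)
qed

lemma link_adj_commute: "link_adj n R v w = link_adj n R w v"
proof -
  have "real (link_adj n R v w) = real (link_adj n R w v)"
    unfolding real_link_adj by (intro sum.cong refl rel_adj_commute)
  then show ?thesis by simp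
qed

text \<open>Substitute \<open>x = D^(1/2) y\<close>, which is invertible since all degrees are
  positive: the Rayleigh bound at \<open>x\<close> becomes positivity of the form of
  \<open>D / 2 - A\<close> at \<open>y\<close>. That \<open>y\<close> sums to zero means that
  \<open>x\<close> is orthogonal to \<open>D^(-1/2) 1\<close>, rather than to the eigenvector
  \<open>D^(1/2) 1\<close>; \<open>lambda2_greater\<close> works with any hyperplane.\<close>

lemma lambda2_link_laplacian_greater:
  assumes n: "1 \<le> n"
    and deg: "\<And>v. v < 2 * n \<Longrightarrow> 0 < link_deg n R v"
    and gap: "\<And>y. (\<Sum>v<2 * n. y v) = 0 \<Longrightarrow> 0 < (\<Sum>v<2 * n. (y v)\<^sup>2) \<Longrightarrow>
      (\<Sum>v<2 * n. \<Sum>w<2 * n. real (link_adj n R v w) * (y v * y w)) <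
      (\<Sum>v<2 * n. real (link_deg n R v) * ((y v)\<^sup>2 / 2))"
  shows "1 / 2 < lambda2 (link_laplacian n R)"
proof (rule lambda2_greater)
  let ?D = "\<lambda>v. real (link_deg n R v)"
  let ?L = "link_laplacian n R"
  show L: "?L \<in> carrier_mat (2 * n) (2 * n)" by (simp add: link_laplacian_def)
  show "?L\<^sup>T = ?L"
    by (rule eq_matI) (auto simp: link_laplacian_def link_adj_commute[of n R] mult.commute)
  show "2 \<le> 2 * n" using n by simp
  show "Matrix.vec (2 * n) (\<lambda>v. 1 / sqrt (?D v)) \<in> carrier_vec (2 * n)" by simp
  fix x :: "real Matrix.vec"
  assume x: "x \<in> carrier_vec (2 * n)" "x \<noteq> 0\<^sub>v (2 * n)"
    and orth: "Matrix.vec (2 * n) (\<lambda>v. 1 / sqrt (?D v)) \<bullet> x = 0"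
  define y where "y v = x $ v / sqrt (?D v)" for v
  have xy: "x $ v = sqrt (?D v) * y v" if "v < 2 * n" for v
    using deg[OF that] by (simp add: y_def)
  have sum0: "(\<Sum>v<2 * n. y v) = 0"
    using orth x(1) by (simp add: scalar_prod_def y_def atLeast0LessThan)
  have pos: "0 < (\<Sum>v<2 * n. (y v)\<^sup>2)"
  proof -
    obtain v where v: "v < 2 * n" "x $ v \<noteq> 0"
      using x by (metis carrier_vecD eq_vecI index_zero_vec)
    then have "0 < (y v)\<^sup>2" using xy[of v] by auto
    also have "\<dots> \<le> (\<Sum>v<2 * n. (y v)\<^sup>2)"
      using v(1) by (intro member_le_sum) auto
    finally show ?thesis .
  qed
  have xx: "x \<bullet> x = (\<Sum>v<2 * n. ?D v * (y v)\<^sup>2)"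
    using x(1) xy by (auto simp: scalar_prod_def atLeast0LessThan power2_eq_square intro!: sum.cong)
  \<comment> \<open>Off the diagonal equality holds. On the diagonal the Laplacian entry is 1
    whatever \<open>link_adj\<close> is, and the nonnegative adjacency term is dropped.\<close>
  have entry: "of_bool (v = w) * (x $ v * x $ w) - real (link_adj n R v w) * (y v * y w)
      \<le> x $ v * (?L $$ (v, w) * x $ w)" if vw: "v < 2 * n" "w < 2 * n" for v w
  proof (cases "v = w")
    case True
    have "0 \<le> real (link_adj n R v w) * (y v * y w)" by (simp add: True)
    then show ?thesis using True vw deg by (simp add: link_laplacian_def)
  next
    case False
    then show ?thesis using vw by (simp add: link_laplacian_def y_def real_sqrt_mult mult_ac)
  qed
  have "x \<bullet> x - (\<Sum>v<2 * n. \<Sum>w<2 * n. real (link_adj n R v w) * (y v * y w)) =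
      (\<Sum>v<2 * n. \<Sum>w<2 * n. of_bool (v = w) * (x $ v * x $ w) - real (link_adj n R v w) * (y v * y w))"
  proof -
    have "(\<Sum>w<2 * n. of_bool (v = w) * (x $ v * x $ w)) = x $ v * x $ v" if "v < 2 * n" for v
      by (rule sum_of_bool_eq(2)[OF that])
    then have "(\<Sum>v<2 * n. \<Sum>w<2 * n. of_bool (v = w) * (x $ v * x $ w)) = (\<Sum>v<2 * n. x $ v * x $ v)"
      by (intro sum.cong refl) (simp only: lessThan_iff)
    then show ?thesis
      unfolding sum_subtractf using x(1) by (simp add: scalar_prod_def atLeast0LessThan)
  qed
  also have "\<dots> \<le> (\<Sum>v<2 * n. \<Sum>w<2 * n. x $ v * (?L $$ (v, w) * x $ w))"
    by (intro sum_mono entry) auto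
  also have "\<dots> = x \<bullet> (?L *\<^sub>v x)"
    using x(1) L by (simp add: scalar_prod_def atLeast0LessThan sum_distrib_left)
  finally have "x \<bullet> x - (\<Sum>v<2 * n. \<Sum>w<2 * n. real (link_adj n R v w) * (y v * y w)) \<le> x \<bullet> (?L *\<^sub>v x)" .
  moreover have "(\<Sum>v<2 * n. \<Sum>w<2 * n. real (link_adj n R v w) * (y v * y w)) < x \<bullet> x / 2"
    using gap[OF sum0 pos] unfolding xx by (simp add: sum_divide_distrib)
  ultimately show "1 / 2 * (x \<bullet> x) < x \<bullet> (?L *\<^sub>v x)" by linarith
qed

section \<open>The centered matrix and its comparison with the mean\<close>

definition centered_mat :: "nat \<Rightarrow> real \<Rightarrow> (nat \<times> nat \<times> nat \<Rightarrow> bool) \<Rightarrow> nat \<Rightarrow> nat \<Rightarrow> real" where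
  "centered_mat n p f v w = (\<Sum>r\<in>tri_words n. (of_bool (f r) - p) * rel_mat n r v w)"

lemma quad_form_centered_mat:
  "quad_form (2 * n) (centered_mat n p f) x =
    (\<Sum>v<2 * n. real (link_deg n (relators_of n f) v) * ((x v)\<^sup>2 / 2)) -
    (\<Sum>v<2 * n. \<Sum>w<2 * n. real (link_adj n (relators_of n f) v w) * (x v * x w)) -
    p * (\<Sum>r\<in>tri_words n. quad_form (2 * n) (rel_mat n r) x)"
proof -
  have "quad_form (2 * n) (centered_mat n p f) x =
      (\<Sum>r\<in>tri_words n. (of_bool (f r) - p) * quad_form (2 * n) (rel_mat n r) x)"
    unfolding centered_mat_def by (rule quad_form_sum)
  also have "\<dots> = (\<Sum>r\<in>tri_words n. of_bool (f r) * quad_form (2 * n) (rel_mat n r) x) -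
      p * (\<Sum>r\<in>tri_words n. quad_form (2 * n) (rel_mat n r) x)"
    by (simp only: left_diff_distrib sum_subtractf sum_distrib_left)
  also have "(\<Sum>r\<in>tri_words n. of_bool (f r) * quad_form (2 * n) (rel_mat n r) x) =
      (\<Sum>r\<in>relators_of n f. quad_form (2 * n) (rel_mat n r) x)"
    by (rule sum.mono_neutral_cong_right) (auto simp: relators_of_def finite_tri_words)
  also have "\<dots> = (\<Sum>v<2 * n. real (link_deg n (relators_of n f) v) * ((x v)\<^sup>2 / 2)) -
    (\<Sum>v<2 * n. \<Sum>w<2 * n. real (link_adj n (relators_of n f) v w) * (x v * x w))"
    by (rule sum_quad_form_relators) (auto simp: relators_of_def)
  finally show ?thesis .
qed

text \<open>The deterministic part exceeds \<open>3 p n^2\<close> times the squared length at the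
  indicator of each letter and at every nonzero vector of sum zero, so the perturbation cannot
  cancel it. The first case gives positive degrees, the second the gap.\<close>

lemma lambda2_greater_of_quad_form_bound:
  assumes n: "2 \<le> n" and p: "0 < p"
    and bound: "\<And>x. \<bar>quad_form (2 * n) (centered_mat n p f) x\<bar> \<le> 3 * p * (real n)\<^sup>2 * (\<Sum>v<2 * n. (x v)\<^sup>2)"
  shows "1 / 2 < lambda2 (link_laplacian n (relators_of n f))"
proof (rule lambda2_link_laplacian_greater)
  let ?R = "relators_of n f"
  show "1 \<le> n" using n by simp
  \<comment> \<open>The common margin: up to the factor \<open>3 p\<close>, the right side is the
    deterministic diagonal entry, and it also bounds from below the coefficient for vectors of sum
    zero.\<close>
  have n2: "(real n)\<^sup>2 < (2 * real n - 2) * (2 * real n - 1) + 1"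
  proof -
    have "(2 * real n - 2) * (2 * real n - 1) + 1 - (real n)\<^sup>2 = 3 * (real n - 2) * real n + 3"
      by (simp add: algebra_simps power2_eq_square)
    moreover have "0 \<le> 3 * (real n - 2) * real n" using n by simp
    ultimately show ?thesis by linarith
  qed
  show "0 < link_deg n ?R v" if v: "v < 2 * n" for v
  proof -
    define x where "x u = (of_bool (u = v) :: real)" for u
    have sq: "(x u)\<^sup>2 = x u" for u by (simp add: x_def)
    have sum: "(\<Sum>u<2 * n. x u * g u) = g v" for g
      unfolding x_def by (rule sum_of_bool_eq(1)[OF v])
    have S: "(\<Sum>u<2 * n. x u) = 1" using sum[of "\<lambda>_. 1"] by simp
    have inv: "x (letter_inv n v) = 0" using letter_inv_neq[OF v] by (simp add: x_def)
    have Q: "(\<Sum>r\<in>tri_words n. quad_form (2 * n) (rel_mat n r) x) = 3 * ((2 * real n - 2) * (2 * real n - 1) + 1)"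
      unfolding sum_quad_form_rel_mat sq S sum inv by simp
    have D: "(\<Sum>u<2 * n. real (link_deg n ?R u) * ((x u)\<^sup>2 / 2)) = real (link_deg n ?R v) / 2"
      using sum[of "\<lambda>u. real (link_deg n ?R u) / 2"] by (simp add: sq mult.commute)
    have A: "0 \<le> (\<Sum>u<2 * n. \<Sum>w<2 * n. real (link_adj n ?R u w) * (x u * x w))"
      by (intro sum_nonneg) (simp add: x_def)
    have "3 * p * (real n)\<^sup>2 < p * (\<Sum>r\<in>tri_words n. quad_form (2 * n) (rel_mat n r) x)"
      unfolding Q using n2 p by simp
    then have "0 < real (link_deg n ?R v) / 2"
      using bound[of x] A unfolding quad_form_centered_mat D unfolding sq S by linarith
    then show ?thesis by simp
  qed
  fix y :: "nat \<Rightarrow> real"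
  assume y: "(\<Sum>v<2 * n. y v) = 0" and pos: "0 < (\<Sum>v<2 * n. (y v)\<^sup>2)"
  let ?S = "\<Sum>v<2 * n. (y v)\<^sup>2"
  \<comment> \<open>Since inversion permutes the letters, \<open>2 a b \<le> a^2 + b^2\<close>
    bounds the bracket of inverse pairs below by \<open>- ?S\<close>; this is the \<open>- 1\<close>
    further down.\<close>
  have "2 * (\<Sum>v<2 * n. y v * y (letter_inv n v)) \<le> (\<Sum>v<2 * n. (y v)\<^sup>2 + (y (letter_inv n v))\<^sup>2)"
    unfolding sum_distrib_left
  proof (rule sum_mono)
    fix v show "2 * (y v * y (letter_inv n v)) \<le> (y v)\<^sup>2 + (y (letter_inv n v))\<^sup>2"
      using sum_squares_bound[of "y v" "y (letter_inv n v)"] by (simp add: mult.assoc)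
  qed
  also have "\<dots> = 2 * ?S"
    using sum_letter_inv[of "\<lambda>v. (y v)\<^sup>2" n] by (simp add: sum.distrib)
  finally have inv: "2 * (\<Sum>v<2 * n. y v * y (letter_inv n v)) \<le> 2 * ?S" .
  have "3 * (real n)\<^sup>2 * ?S < 3 * ((2 * real n - 2) * (2 * real n + 1) - 1) * ?S"
  proof (rule mult_strict_right_mono[OF _ pos])
    have "(2 * real n - 2) * (2 * real n + 1) - 1 = (2 * real n - 2) * (2 * real n - 1) + 1 + (4 * real n - 6)"
      by (simp add: algebra_simps)
    moreover have "2 \<le> real n" using n by simp
    ultimately have "(real n)\<^sup>2 < (2 * real n - 2) * (2 * real n + 1) - 1"
      using n2 by simp
    then show "3 * (real n)\<^sup>2 < 3 * ((2 * real n - 2) * (2 * real n + 1) - 1)"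
      by (intro mult_strict_left_mono) auto
  qed
  also have "\<dots> \<le> (\<Sum>r\<in>tri_words n. quad_form (2 * n) (rel_mat n r) y)"
    unfolding sum_quad_form_rel_mat y using inv by (simp add: algebra_simps)
  finally have "p * (3 * (real n)\<^sup>2 * ?S) < p * (\<Sum>r\<in>tri_words n. quad_form (2 * n) (rel_mat n r) y)"
    using p by (rule mult_strict_left_mono)
  then show "(\<Sum>v<2 * n. \<Sum>w<2 * n. real (link_adj n ?R v w) * (y v * y w)) <
      (\<Sum>v<2 * n. real (link_deg n ?R v) * ((y v)\<^sup>2 / 2))"
    using bound[of y] unfolding quad_form_centered_mat by (simp add: mult_ac)
qed

section \<open>The random presentation\<close>

lemma symmetric_centered_mat: "symmetric_upto (2 * n) (centered_mat n p f)"
  unfolding symmetric_upto_def centered_mat_def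
  by (intro allI impI sum.cong refl) (simp only: symmetric_rel_mat)

text \<open>Markov's inequality for the trace of the \<open>2 k\<close>-th power at level
  \<open>\<theta>^(2 k)\<close>, where \<open>\<theta>\<close> is the norm tolerated by
  \<open>lambda2_greater_of_quad_form_bound\<close>.\<close>

lemma prob_lambda2_le:
  assumes n: "2 \<le> n" and p: "0 < p" "p \<le> 1" and k: "k = 2 ^ j"
    and kp: "10 * real k \<le> 36 * p * (real n)\<^sup>2"
  shows "measure_pmf.prob (random_tri_pres n p) {f. lambda2 (link_laplacian n (relators_of n f)) \<le> 1 / 2}
    \<le> 2 * real n * (160 * real k / (p * (real n)\<^sup>2)) ^ k"
proof -
  let ?P = "random_tri_pres n p"
  let ?tr = "\<lambda>f. ftrace (2 * n) (fpow (2 * n) (centered_mat n p f) (2 * k))"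
  define \<theta> where "\<theta> = 3 * p * (real n)\<^sup>2"
  \<comment> \<open>Chosen so that new and repeated letters cost the same:
    \<open>z * B = 10 k = c * 2 k\<close> with \<open>B = 36 n^2\<close> and \<open>c = 5\<close>.
    The assumption on \<open>k\<close> is exactly \<open>z \<le> p\<close>.\<close>
  define z where "z = 10 * real k / (36 * (real n)\<^sup>2)"
  have k0: "0 < k" using k by simp
  have n0: "0 < (real n)\<^sup>2" using n by simp
  have z0: "0 < z" using k0 n0 by (simp add: z_def)
  have zp: "z \<le> p" using kp n0 by (simp add: z_def field_simps)
  have \<theta>: "0 < \<theta>" using p n0 by (simp add: \<theta>_def)
  have k2: "2 * k = 2 ^ Suc j" using k by simp
  have tr_nonneg: "0 \<le> ?tr f" for f
    unfolding mult_2[of k] ftrace_fpow_double[OF symmetric_centered_mat] by (intro sum_nonneg) simp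
  have int: "integrable (measure_pmf ?P) h" for h :: "_ \<Rightarrow> real"
    unfolding random_tri_pres_def
    by (intro integrable_measure_pmf_finite finite_set_Pi_pmf_bernoulli finite_tri_words)
  have sub: "{f. lambda2 (link_laplacian n (relators_of n f)) \<le> 1 / 2} \<subseteq> {f. \<theta> ^ (2 * k) \<le> ?tr f}"
  proof
    fix f assume f: "f \<in> {f. lambda2 (link_laplacian n (relators_of n f)) \<le> 1 / 2}"
    show "f \<in> {f. \<theta> ^ (2 * k) \<le> ?tr f}"
    proof (rule ccontr)
      assume "f \<notin> {f. \<theta> ^ (2 * k) \<le> ?tr f}"
      then have tr: "?tr f \<le> \<theta> ^ (2 * k)" by simp
      have "\<bar>quad_form (2 * n) (centered_mat n p f) x\<bar> \<le> 3 * p * (real n)\<^sup>2 * (\<Sum>v<2 * n. (x v)\<^sup>2)" for x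
        using abs_quad_form_le[OF symmetric_centered_mat _ k2 tr] \<theta> by (simp add: \<theta>_def)
      then have "1 / 2 < lambda2 (link_laplacian n (relators_of n f))"
        by (rule lambda2_greater_of_quad_form_bound[OF n p(1)])
      then show False using f by simp
    qed
  qed
  have "measure_pmf.expectation ?P ?tr \<le> (p / z) ^ k * (real (2 * n) * (z * (36 * (real n)\<^sup>2) + 5 * real (2 * k)) ^ (2 * k))"
    unfolding random_tri_pres_def centered_mat_def[abs_def]
  proof (rule expectation_ftrace_fpow_le[OF finite_tri_words z0 zp p(2)])
    fix r u assume ru: "r \<in> tri_words n" "u < 2 * n"
    \<comment> \<open>The column sum is at most \<open>3 / 2 * 3\<close>, rounded up.\<close>
    show "(\<Sum>v<2 * n. \<bar>rel_mat n r v u\<bar>) \<le> 5"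
      using abs_rel_mat_column_sum_le[OF ru] rel_deg_le[OF ru(1), of u] by linarith
  qed (auto intro: sum_abs_rel_mat_column_sum_le)
  also have "z * (36 * (real n)\<^sup>2) + 5 * real (2 * k) = 20 * real k"
    using n0 by (simp add: z_def)
  also have "(p / z) ^ k * (real (2 * n) * (20 * real k) ^ (2 * k)) =
      2 * real n * (p / z * (20 * real k)\<^sup>2) ^ k"
    unfolding power_mult[of "20 * real k" 2 k] power_mult_distrib[of "p / z"] by simp
  also have "p / z * (20 * real k)\<^sup>2 = 1440 * p * (real n)\<^sup>2 * real k"
    using k0 n0 by (simp add: z_def field_simps power2_eq_square)
  finally have E: "measure_pmf.expectation ?P ?tr \<le> 2 * real n * (1440 * p * (real n)\<^sup>2 * real k) ^ k" .
  have "measure_pmf.prob ?P {f. lambda2 (link_laplacian n (relators_of n f)) \<le> 1 / 2}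
      \<le> measure_pmf.prob ?P {f. \<theta> ^ (2 * k) \<le> ?tr f}"
    by (intro measure_pmf.finite_measure_mono sub) simp
  also have "\<dots> \<le> measure_pmf.expectation ?P ?tr / \<theta> ^ (2 * k)"
    using integral_Markov_inequality_measure[where M = "measure_pmf ?P" and u = ?tr and A = "{}" and c = "\<theta> ^ (2 * k)"]
      int tr_nonneg \<theta> by simp
  also have "\<dots> \<le> 2 * real n * (1440 * p * (real n)\<^sup>2 * real k) ^ k / \<theta> ^ (2 * k)"
    using E \<theta> by (intro divide_right_mono) auto
  also have "\<dots> = 2 * real n * (1440 * p * (real n)\<^sup>2 * real k / \<theta>\<^sup>2) ^ k"
    unfolding power_mult[of \<theta> 2 k] power_divide by simp
  also have "1440 * p * (real n)\<^sup>2 * real k / \<theta>\<^sup>2 = 160 * real k / (p * (real n)\<^sup>2)"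
    using p n0 by (simp add: \<theta>_def field_simps power2_eq_square)
  finally show ?thesis .
qed

section \<open>Choice of the exponent and of the constant\<close>

lemma ex_power_two_between:
  fixes a :: real
  assumes "1 \<le> a"
  obtains j where "a \<le> 2 ^ j" "2 ^ j \<le> 2 * a"
proof -
  define j where "j = (LEAST j. a \<le> 2 ^ j)"
  have "\<exists>j. a \<le> 2 ^ j"
    using real_arch_pow[of 2 a] by (auto intro: less_imp_le)
  then have j: "a \<le> 2 ^ j" unfolding j_def by (rule LeastI_ex)
  have "2 ^ j \<le> 2 * a"
  proof (cases j)
    case 0
    then show ?thesis using assms by simp
  next
    case (Suc i)
    then have "\<not> a \<le> 2 ^ i" using not_less_Least[of i "\<lambda>j. a \<le> 2 ^ j"] by (simp add: j_def)
    then show ?thesis using Suc by simp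
  qed
  then show ?thesis using that j by blast
qed

text \<open>With \<open>k\<close> between \<open>ln n\<close> and \<open>2 ln n\<close> the base of
  the power is at most \<open>exp (- 2)\<close>, so the failure probability is at most
  \<open>2 n exp (- 2 k) \<le> 2 / n\<close>.\<close>

lemma prob_lambda2_greater_ge:
  assumes n: "3 \<le> n" and p: "p \<le> 1" "3000 * ln (real n) / (real n)\<^sup>2 \<le> p"
  shows "1 - 2 / real n \<le> measure_pmf.prob (random_tri_pres n p)
    {f. 1 / 2 < lambda2 (link_laplacian n (relators_of n f))}"
proof -
  let ?P = "random_tri_pres n p"
  let ?good = "{f. 1 / 2 < lambda2 (link_laplacian n (relators_of n f))}"
  have e: "exp 1 \<le> (3 :: real)" by (rule exp_le)
  have ln1: "1 \<le> ln (real n)"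
    using n e by (subst ln_ge_iff) auto
  have n0: "0 < (real n)\<^sup>2" using n by simp
  have pn: "3000 * ln (real n) \<le> p * (real n)\<^sup>2"
    using p(2) n0 by (simp add: field_simps)
  have pn0: "0 < p * (real n)\<^sup>2" using pn ln1 by linarith
  then have p0: "0 < p" using n0 by (simp add: zero_less_mult_iff)
  obtain j where j: "ln (real n) \<le> 2 ^ j" "2 ^ j \<le> 2 * ln (real n)"
    using ex_power_two_between[OF ln1] by blast
  define k :: nat where "k = 2 ^ j"
  have k: "ln (real n) \<le> real k" "real k \<le> 2 * ln (real n)" using j by (simp_all add: k_def)
  \<comment> \<open>The constant 3000 enters here:
    \<open>320 / 3000 \<le> 1 / 9 \<le> exp (- 2)\<close>, the last because
    \<open>exp 1 \<le> 3\<close>.\<close>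
  have "160 * real k / (p * (real n)\<^sup>2) \<le> 320 * ln (real n) / (3000 * ln (real n))"
    using k pn ln1 by (intro frac_le) auto
  also have "\<dots> \<le> 1 / 9" using ln1 by simp
  also have "\<dots> \<le> exp (- 2)"
  proof -
    have "exp 2 = (exp 1 :: real)\<^sup>2" by (simp flip: exp_of_nat_mult)
    also have "\<dots> \<le> 3\<^sup>2" using e by (intro power_mono) auto
    finally show ?thesis by (simp add: exp_minus field_simps)
  qed
  finally have base: "160 * real k / (p * (real n)\<^sup>2) \<le> exp (- 2)" .
  have "measure_pmf.prob ?P {f. lambda2 (link_laplacian n (relators_of n f)) \<le> 1 / 2}
      \<le> 2 * real n * (160 * real k / (p * (real n)\<^sup>2)) ^ k"
    using n p0 p(1) k pn ln1 by (intro prob_lambda2_le[where j = j]) (auto simp: k_def)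
  also have "\<dots> \<le> 2 * real n * exp (- 2) ^ k"
    using base pn0 by (intro mult_left_mono power_mono) auto
  also have "exp (- 2) ^ k = exp (- 2 * real k)"
    by (simp flip: exp_of_nat_mult add: mult.commute)
  also have "2 * real n * \<dots> \<le> 2 * real n * exp (- 2 * ln (real n))"
    using k by (intro mult_left_mono) auto
  also have "exp (- 2 * ln (real n)) = 1 / (real n)\<^sup>2"
    using n by (simp add: exp_minus exp_double field_simps)
  also have "2 * real n * (1 / (real n)\<^sup>2) = 2 / real n"
    by (simp add: power2_eq_square)
  finally have bad: "measure_pmf.prob ?P {f. lambda2 (link_laplacian n (relators_of n f)) \<le> 1 / 2} \<le> 2 / real n" .
  have "{f. lambda2 (link_laplacian n (relators_of n f)) \<le> 1 / 2} = UNIV - ?good" by auto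
  then have "measure_pmf.prob ?P {f. lambda2 (link_laplacian n (relators_of n f)) \<le> 1 / 2} =
      1 - measure_pmf.prob ?P ?good"
    using measure_pmf.prob_compl[of ?good ?P] by simp
  then show ?thesis using bad by linarith
qed

theorem theorem4p4:
  "\<exists>C > 0. \<forall>p :: nat \<Rightarrow> real.
     (\<forall>n. 0 \<le> p n \<and> p n \<le> 1) \<longrightarrow>
     (\<forall>\<^sub>F n in sequentially. p n \<ge> C * ln (real n) / (real n)^2) \<longrightarrow>
     (\<lambda>n. measure_pmf.prob (random_tri_pres n (p n))
        {f. lambda2 (link_laplacian n (relators_of n f)) > 1/2}) \<longlonglongrightarrow> 1"
proof (intro exI[of _ 3000] conjI allI impI)
  fix p :: "nat \<Rightarrow> real"
  assume p: "\<forall>n. 0 \<le> p n \<and> p n \<le> 1"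
    and ev: "\<forall>\<^sub>F n in sequentially. p n \<ge> 3000 * ln (real n) / (real n)^2"
  let ?prob = "\<lambda>n. measure_pmf.prob (random_tri_pres n (p n))
        {f. lambda2 (link_laplacian n (relators_of n f)) > 1/2}"
  show "?prob \<longlonglongrightarrow> 1"
  proof (rule tendsto_sandwich)
    show "\<forall>\<^sub>F n in sequentially. 1 - 2 / real n \<le> ?prob n"
      using ev eventually_ge_at_top[of 3] by eventually_elim (use p prob_lambda2_greater_ge in blast)
    show "\<forall>\<^sub>F n in sequentially. ?prob n \<le> 1" by simp
    have "(\<lambda>n. 1 - 2 / real n) \<longlonglongrightarrow> 1 - 0"
      by (intro tendsto_intros lim_const_over_n)
    then show "(\<lambda>n. 1 - 2 / real n) \<longlonglongrightarrow> 1" by simp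
    show "(\<lambda>n. 1) \<longlonglongrightarrow> (1 :: real)" by simp
  qed
qed simp

end
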